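(* Let $\Gamma$ and $\Lambda$ be finitely generated groups with volume growth functions $V_\Gamma$ and $V_\Lambda$. Assume that there exist two increasing functions $f_\Gamma$ and $f_\Lambda$ such that $f_\Gamma\approx V_\Gamma$, $f_\Lambda\approx V_\Lambda$, and, as $x\to+\infty$: (i) $f_\Gamma^{-1}(x)=o(f_\Lambda^{-1}(x))$; (ii) for every $C>0$, $f_\Gamma^{-1}(Cx)=O(f_\Gamma^{-1}(x))$; (iii) for every $C>0$, $f_\Gamma^{-1}\circ f_\Lambda(Cx)=O(f_\Gamma^{-1}\circ f_\Lambda(x))$. Then there is no $(f_\Gamma^{-1}\circ f_\Lambda,\mathrm{L}^0)$-integrable measure equivalence coupling from $\Gamma$ to $\Lambda$.
   Context: Asymptotic comparison: for non-decreasing real functions $f,g$ defined near $+\infty$, $f\preccurlyeq g$ means there is $C>0$ with $f(x)=O(g(Cx))$ as $x\to+\infty$; $f\approx g$ means $f\preccurlyeq g$ and $g\preccurlyeq f$. Volume growth: for a finite generating set $S_\Gamma$, $V_\Gamma(n)$ is the number of elements of $\Gamma$ that can be written as a product of $n$ elements of $S_\Gamma\cup S_\Gamma^{-1}\cup\{e\}$, extended to a continuous non-decreasing function on $\mathbb{R}_+$ (well defined up to $\approx$). Measure equivalence coupling between countable groups $\Gamma,\Lambda$: a quadruple $(\Omega,X_\Gamma,X_\Lambda,\mu)$ where $(\Omega,\mu)$ is a standard Borel measure space with commuting, free, measure-preserving actions $\gamma\ast x$, $\lambda\ast x$ of $\Gamma$ and $\Lambda$, and $X_\Gamma$ (resp.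 $X_\Lambda$) is a Borel fundamental domain of finite measure for the $\Gamma$-action (resp. $\Lambda$-action). For $\gamma\in\Gamma$ and $x\in X_\Lambda$, $\gamma\cdot x$ is the unique point of $(\Lambda\ast\gamma\ast x)\cap X_\Lambda$, and the cocycle $c_{\Lambda,\Gamma}\colon\Gamma\times X_\Lambda\to\Lambda$ is defined by $c_{\Lambda,\Gamma}(\gamma,x)\ast\gamma\ast x=\gamma\cdot x$; symmetrically one defines $c_{\Gamma,\Lambda}\colon\Lambda\times X_\Gamma\to\Gamma$. For a non-decreasing $\varphi\colon\mathbb{R}_+\to\mathbb{R}_+$, $c_{\Lambda,\Gamma}$ is $\varphi$-integrable if for every $\gamma\in\Gamma$ there is $c_\gamma>0$ with $\int_{X_\Lambda}\varphi(|c_{\Lambda,\Gamma}(\gamma,x)|_{S_\Lambda}/c_\gamma)\,d\mu(x)<+\infty$, where $|\cdot|_{S_\Lambda}$ is the word length for a finite generating set $S_\Lambda$ of $\Lambda$. A coupling is a $(\varphi,\mathrm{L}^0)$-integrable measure equivalence coupling from $\Gamma$ to $\Lambda$ if $c_{\Lambda,\Gamma}$ is $\varphi$-integrable (no requirement on $c_{\Gamma,\Lambda}$). *)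

theory Defs
  imports "HOL-Probability.Probability" "HOL-Algebra.Algebra" "HOL-Library.Landau_Symbols"
begin

primrec word_ball :: "('g, 'b) monoid_scheme \<Rightarrow> 'g set \<Rightarrow> nat \<Rightarrow> 'g set" where
  "word_ball G S 0 = {one G}"
| "word_ball G S (Suc n) =
     {mult G x s | x s. x \<in> word_ball G S n \<and> s \<in> S \<union> (m_inv G) ` S \<union> {one G}}"

definition word_length :: "('g, 'b) monoid_scheme \<Rightarrow> 'g set \<Rightarrow> 'g \<Rightarrow> nat" where
  "word_length G S g = (LEAST n. g \<in> word_ball G S n)"

definition fin_gen_set :: "('g, 'b) monoid_scheme \<Rightarrow> 'g set \<Rightarrow> bool" where
  "fin_gen_set G S \<longleftrightarrow> finite S \<and> S \<subseteq> carrier G \<and> generate G S = carrier G"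

text \<open>Volume growth on integers, extended piecewise linearly to a continuous
  non-decreasing function on the non-negative reals.\<close>
definition vol_nat :: "('g, 'b) monoid_scheme \<Rightarrow> 'g set \<Rightarrow> nat \<Rightarrow> real" where
  "vol_nat G S n = real (card (word_ball G S n))"

definition vol_growth :: "('g, 'b) monoid_scheme \<Rightarrow> 'g set \<Rightarrow> real \<Rightarrow> real" where
  "vol_growth G S x =
     (let n = nat \<lfloor>x\<rfloor>; t = x - real n in
        vol_nat G S n + t * (vol_nat G S (Suc n) - vol_nat G S n))"

definition asym_le :: "(real \<Rightarrow> real) \<Rightarrow> (real \<Rightarrow> real) \<Rightarrow> bool" where
  "asym_le f g \<longleftrightarrow> (\<exists>C>0. f \<in> O[at_top](\<lambda>x. g (C * x)))"

definition asym_eq :: "(real \<Rightarrow> real) \<Rightarrow> (real \<Rightarrow> real) \<Rightarrow> bool" where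
  "asym_eq f g \<longleftrightarrow> asym_le f g \<and> asym_le g f"

definition finv :: "(real \<Rightarrow> real) \<Rightarrow> real \<Rightarrow> real" where
  "finv f = inv_into {0..} f"

definition free_mp_action ::
  "('g, 'b) monoid_scheme \<Rightarrow> 'w measure \<Rightarrow> ('g \<Rightarrow> 'w \<Rightarrow> 'w) \<Rightarrow> bool" where
  "free_mp_action G M a \<longleftrightarrow>
     (\<forall>x \<in> space M. a (one G) x = x) \<and>
     (\<forall>g \<in> carrier G. \<forall>h \<in> carrier G. \<forall>x \<in> space M. a (mult G g h) x = a g (a h x)) \<and>
     (\<forall>g \<in> carrier G. a g \<in> measurable M M \<and> distr M M (a g) = M) \<and>
     (\<forall>g \<in> carrier G. \<forall>x \<in> space M. a g x = x \<longrightarrow> g = one G)"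

definition fund_domain ::
  "('g, 'b) monoid_scheme \<Rightarrow> 'w measure \<Rightarrow> ('g \<Rightarrow> 'w \<Rightarrow> 'w) \<Rightarrow> 'w set \<Rightarrow> bool" where
  "fund_domain G M a D \<longleftrightarrow> D \<in> sets M \<and> (emeasure M D < Orderings.top) \<and>
     (\<forall>x \<in> space M. \<exists>!g. g \<in> carrier G \<and> a g x \<in> D)"

text \<open>ME coupling (\<Omega>, X_G, X_L, \<mu>) between G and L, on a standard Borel space
  (a Polish space with its Borel sets).\<close>
definition me_coupling ::
  "('g, 'b) monoid_scheme \<Rightarrow> ('l, 'c) monoid_scheme \<Rightarrow> 'w::polish_space measure \<Rightarrow>
   ('g \<Rightarrow> 'w \<Rightarrow> 'w) \<Rightarrow> ('l \<Rightarrow> 'w \<Rightarrow> 'w) \<Rightarrow> 'w set \<Rightarrow> 'w set \<Rightarrow> bool" where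
  "me_coupling G L M aG aL XG XL \<longleftrightarrow>
     sets M = sets borel \<and>
     free_mp_action G M aG \<and> free_mp_action L M aL \<and>
     (\<forall>g \<in> carrier G. \<forall>l \<in> carrier L. \<forall>x \<in> space M. aG g (aL l x) = aL l (aG g x)) \<and>
     fund_domain G M aG XG \<and> fund_domain L M aL XL \<and>
     0 < emeasure M XL"

definition me_cocycle ::
  "('l, 'c) monoid_scheme \<Rightarrow> ('g \<Rightarrow> 'w \<Rightarrow> 'w) \<Rightarrow> ('l \<Rightarrow> 'w \<Rightarrow> 'w) \<Rightarrow> 'w set \<Rightarrow> 'g \<Rightarrow> 'w \<Rightarrow> 'l" where
  "me_cocycle L aG aL XL g x = (THE l. l \<in> carrier L \<and> aL l (aG g x) \<in> XL)"

definition phi_integrable_cocycle ::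
  "(real \<Rightarrow> real) \<Rightarrow> ('g, 'b) monoid_scheme \<Rightarrow> ('l, 'c) monoid_scheme \<Rightarrow> 'l set \<Rightarrow>
   'w measure \<Rightarrow> ('g \<Rightarrow> 'w \<Rightarrow> 'w) \<Rightarrow> ('l \<Rightarrow> 'w \<Rightarrow> 'w) \<Rightarrow> 'w set \<Rightarrow> bool" where
  "phi_integrable_cocycle \<phi> G L SL M aG aL XL \<longleftrightarrow>
     (\<forall>g \<in> carrier G. \<exists>c>0.
        (\<integral>\<^sup>+ x \<in> XL. ennreal (\<phi> (real (word_length L SL (me_cocycle L aG aL XL g x)) / c)) \<partial>M) < Orderings.top)"

definition phi_L0_coupling ::
  "(real \<Rightarrow> real) \<Rightarrow> ('g, 'b) monoid_scheme \<Rightarrow> ('l, 'c) monoid_scheme \<Rightarrow> 'l set \<Rightarrow>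
   'w::polish_space measure \<Rightarrow> ('g \<Rightarrow> 'w \<Rightarrow> 'w) \<Rightarrow> ('l \<Rightarrow> 'w \<Rightarrow> 'w) \<Rightarrow> 'w set \<Rightarrow> 'w set \<Rightarrow> bool" where
  "phi_L0_coupling \<phi> G L SL M aG aL XG XL \<longleftrightarrow>
     me_coupling G L M aG aL XG XL \<and> phi_integrable_cocycle \<phi> G L SL M aG aL XL"

end

theory Submission
  imports Defs
begin

text \<open>Write \<open>\<phi> = f\<^sub>\<Gamma>\<^sup>-\<^sup>1 \<circ> f\<^sub>\<Lambda>\<close>, so that \<open>\<phi> x = o(x)\<close>. By the cocycle identity the length of the cocycle
  at a word of length \<open>n\<close> is bounded by the sum of \<open>n\<close> terms distributed like the cocycle at
  generators, because \<open>\<Gamma>\<close> preserves the measure on \<open>X\<^sub>\<Lambda>\<close>. Truncate these terms at a scale \<open>R\<close> at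
  which \<open>\<phi> x / x\<close> is nearly a record minimum: \<open>\<phi>\<close>-integrability then makes their truncated means
  \<open>o(R / \<phi> R)\<close>. Hence for every constant \<open>C\<close> there are arbitrarily large \<open>R\<close> such that each element
  of the \<open>\<Gamma>\<close>-ball of radius \<open>C \<phi>(R)\<close> has cocycle of length \<open>O(R)\<close> outside a set of small measure.
  Almost every \<open>\<Gamma>\<close>-orbit meets \<open>X\<^sub>\<Lambda>\<close> in finitely many points, so the cocycle is essentially
  boundedly-many-to-one and \<open>V\<^sub>\<Gamma>(C \<phi>(R)) = O(V\<^sub>\<Lambda>(c R))\<close> with constants independent of \<open>C\<close>. Applying
  \<open>f\<^sub>\<Gamma>\<^sup>-\<^sup>1\<close> and the two doubling hypotheses bounds \<open>C\<close>, a contradiction.\<close>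

section \<open>Word balls\<close>

context group
begin

lemma symmetrised_closed:
  assumes "S \<subseteq> carrier G" "s \<in> S \<union> m_inv G ` S \<union> {\<one>}"
  shows "s \<in> carrier G"
  using assms by auto

lemma word_ball_subset_carrier:
  assumes "S \<subseteq> carrier G"
  shows "word_ball G S n \<subseteq> carrier G"
proof (induction n)
  case (Suc n)
  then show ?case using symmetrised_closed[OF assms] by auto
qed simp

lemma finite_word_ball:
  assumes "finite S"
  shows "finite (word_ball G S n)"
proof (induction n)
  case (Suc n)
  have "word_ball G S (Suc n) =
      (\<lambda>(x, s). x \<otimes> s) ` (word_ball G S n \<times> (S \<union> m_inv G ` S \<union> {\<one>}))"
    by auto
  also have "finite \<dots>" using Suc assms by simp
  finally show ?case .
qed simp

lemma word_ball_mono: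
  assumes "S \<subseteq> carrier G" "m \<le> n"
  shows "word_ball G S m \<subseteq> word_ball G S n"
proof -
  have "word_ball G S k \<subseteq> word_ball G S (Suc k)" for k
  proof
    fix x assume x: "x \<in> word_ball G S k"
    then have "x = x \<otimes> \<one>" using word_ball_subset_carrier[OF assms(1)] by fastforce
    with x show "x \<in> word_ball G S (Suc k)" by auto
  qed
  then show ?thesis using assms(2) by (rule lift_Suc_mono_le)
qed

lemma word_ball_mult:
  assumes S: "S \<subseteq> carrier G" and x: "x \<in> word_ball G S m" and y: "y \<in> word_ball G S n"
  shows "x \<otimes> y \<in> word_ball G S (m + n)"
  using y
proof (induction n arbitrary: y)
  case 0
  then show ?case using x word_ball_subset_carrier[OF S] by fastforce
next
  case (Suc n)
  then obtain z s where zs: "y = z \<otimes> s" "z \<in> word_ball G S n" "s \<in> S \<union> m_inv G ` S \<union> {\<one>}"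
    by auto
  have "x \<otimes> y = (x \<otimes> z) \<otimes> s"
    using zs x word_ball_subset_carrier[OF S] symmetrised_closed[OF S zs(3)]
    by (auto simp: m_assoc subset_iff)
  then show ?case using Suc.IH[OF zs(2)] zs(3) by auto
qed

lemma symmetrised_in_word_ball:
  assumes "S \<subseteq> carrier G" "s \<in> S \<union> m_inv G ` S \<union> {\<one>}"
  shows "s \<in> word_ball G S 1"
proof -
  have "s = \<one> \<otimes> s" using symmetrised_closed[OF assms] by simp
  then show ?thesis using assms(2) by auto
qed

lemma generate_subset_word_balls:
  assumes S: "S \<subseteq> carrier G" and x: "x \<in> generate G S"
  shows "\<exists>n. x \<in> word_ball G S n"
  using x
proof induction
  case one
  show ?case by (intro exI[of _ 0]) simp
next
  case (incl h)
  then show ?case using symmetrised_in_word_ball[OF S, of h] by blast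
next
  case (inv h)
  then show ?case using symmetrised_in_word_ball[OF S, of "inv h"] by blast
next
  case (eng h1 h2)
  then show ?case using word_ball_mult[OF S] by blast
qed

lemma carrier_eq_Union_word_balls:
  assumes "fin_gen_set G S"
  shows "carrier G = (\<Union>n. word_ball G S n)"
proof
  show "carrier G \<subseteq> (\<Union>n. word_ball G S n)"
    using assms generate_subset_word_balls[of S] unfolding fin_gen_set_def by blast
  show "(\<Union>n. word_ball G S n) \<subseteq> carrier G"
    using assms word_ball_subset_carrier[of S] unfolding fin_gen_set_def by blast
qed

lemma countable_carrier:
  assumes "fin_gen_set G S"
  shows "countable (carrier G)"
proof -
  have "countable (\<Union>n. word_ball G S n)"
    using assms by (auto simp: fin_gen_set_def finite_word_ball countable_finite)
  then show ?thesis using carrier_eq_Union_word_balls[OF assms] by simp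
qed

lemma word_length_le:
  assumes "x \<in> word_ball G S n"
  shows "word_length G S x \<le> n"
  unfolding word_length_def using assms by (rule Least_le)

lemma in_word_ball_iff:
  assumes "fin_gen_set G S" "x \<in> carrier G"
  shows "x \<in> word_ball G S n \<longleftrightarrow> word_length G S x \<le> n"
proof -
  have "\<exists>n. x \<in> word_ball G S n" using assms carrier_eq_Union_word_balls by blast
  then have "x \<in> word_ball G S (word_length G S x)"
    unfolding word_length_def by (rule LeastI_ex)
  then show ?thesis
    using word_length_le word_ball_mono[of S] assms(1) unfolding fin_gen_set_def by blast
qed

lemma word_length_mult_le:
  assumes "fin_gen_set G S" "x \<in> carrier G" "y \<in> carrier G"
  shows "word_length G S (x \<otimes> y) \<le> word_length G S x + word_length G S y"
proof (rule word_length_le, rule word_ball_mult)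
  show "S \<subseteq> carrier G" using assms(1) by (simp add: fin_gen_set_def)
qed (simp_all add: assms in_word_ball_iff)

lemma word_length_one [simp]: "word_length G S \<one> = 0"
  using word_length_le[of \<one> S 0] by simp

lemma vol_nat_mono:
  assumes "fin_gen_set G S" "m \<le> n"
  shows "vol_nat G S m \<le> vol_nat G S n"
proof -
  have "card (word_ball G S m) \<le> card (word_ball G S n)"
    using assms by (intro card_mono finite_word_ball word_ball_mono) (auto simp: fin_gen_set_def)
  then show ?thesis by (simp add: vol_nat_def)
qed

lemma vol_nat_floor_le_vol_growth:
  assumes "fin_gen_set G S" "0 \<le> x"
  shows "vol_nat G S (nat \<lfloor>x\<rfloor>) \<le> vol_growth G S x"
  using vol_nat_mono[OF assms(1), of "nat \<lfloor>x\<rfloor>" "Suc (nat \<lfloor>x\<rfloor>)"] assms(2)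
  unfolding vol_growth_def Let_def by simp

end

lemma vol_growth_of_nat [simp]: "vol_growth G S (real n) = vol_nat G S n"
  unfolding vol_growth_def by simp

section \<open>Measure-preserving actions and fundamental domains\<close>

text \<open>Separates the point from the group that moved it: \<open>me_cocycle\<close> at
  \<open>g\<close> and \<open>x\<close> is this function for \<open>aL\<close>, taken at
  \<open>aG g x\<close>. Facts about a single action and its fundamental domain thus apply to
  cocycles.\<close>

definition return_elt :: "('g, 'b) monoid_scheme \<Rightarrow> ('g \<Rightarrow> 'w \<Rightarrow> 'w) \<Rightarrow> 'w set \<Rightarrow> 'w \<Rightarrow> 'g" where
  "return_elt G a D x = (THE g. g \<in> carrier G \<and> a g x \<in> D)"

text \<open>An integral against counting measure with values in \<open>ennreal\<close>, so that
  infinite counts are allowed and Tonelli applies. For a free action it is the number of points of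
  the orbit of \<open>x\<close> in \<open>D\<close>.\<close>

definition orbit_count :: "('g, 'b) monoid_scheme \<Rightarrow> ('g \<Rightarrow> 'w \<Rightarrow> 'w) \<Rightarrow> 'w set \<Rightarrow> 'w \<Rightarrow> ennreal" where
  "orbit_count G a D x = (\<integral>\<^sup>+g. indicator D (a g x) \<partial>count_space (carrier G))"

locale countable_mp_action = group G for G (structure) +
  fixes M :: "'w measure" and a
  assumes act: "free_mp_action G M a"
    and countable_group: "countable (carrier G)"
begin

lemma act_one: "x \<in> space M \<Longrightarrow> a \<one> x = x"
  and act_mult: "\<lbrakk>g \<in> carrier G; h \<in> carrier G; x \<in> space M\<rbrakk> \<Longrightarrow> a (g \<otimes> h) x = a g (a h x)"
  and act_measurable [measurable]: "g \<in> carrier G \<Longrightarrow> a g \<in> measurable M M"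
  and act_distr: "g \<in> carrier G \<Longrightarrow> distr M M (a g) = M"
  using act unfolding free_mp_action_def by auto

lemma act_closed: "\<lbrakk>g \<in> carrier G; x \<in> space M\<rbrakk> \<Longrightarrow> a g x \<in> space M"
  using act_measurable measurable_space by metis

lemma act_inv_act: "\<lbrakk>g \<in> carrier G; x \<in> space M\<rbrakk> \<Longrightarrow> a (inv g) (a g x) = x"
  using act_mult[of "inv g" g x] act_one by simp

lemma nn_integral_act:
  assumes "F \<in> borel_measurable M" "g \<in> carrier G"
  shows "(\<integral>\<^sup>+x. F (a g x) \<partial>M) = (\<integral>\<^sup>+x. F x \<partial>M)"
  using nn_integral_distr[OF act_measurable[OF assms(2)], of F] assms act_distr by simp

section \<open>Orbit counts and mass transport\<close>

lemma orbit_count_measurable [measurable]: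
  assumes [measurable]: "D \<in> sets M"
  shows "orbit_count G a D \<in> borel_measurable M"
proof -
  interpret C: sigma_finite_measure "count_space (carrier G)"
    using countable_group by (rule sigma_finite_measure_count_space_countable)
  have "(\<lambda>p. indicator D (a (snd p) (fst p)) :: ennreal)
      \<in> borel_measurable (M \<Otimes>\<^sub>M count_space (carrier G))"
    using countable_group
    by (intro measurable_compose_countable'[where g = snd and I = "carrier G"
          and f = "\<lambda>g p. indicator D (a g (fst p))"]) measurable
  then show ?thesis
    unfolding orbit_count_def
    by (intro C.borel_measurable_nn_integral) (simp add: case_prod_unfold)
qed

text \<open>Each \<open>g\<close> carries mass from \<open>D\<close> into \<open>E\<close>.
  Substituting along the measure-preserving map \<open>a g\<close> reads this as mass carried from
  \<open>E\<close> into \<open>D\<close> by the inverse of \<open>g\<close>, with the invariant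
  weight \<open>H\<close> unchanged. Summing over the group and reindexing by inverses gives the
  equality.\<close>

lemma mass_transport:
  assumes D[measurable]: "D \<in> sets M" and E[measurable]: "E \<in> sets M"
    and H[measurable]: "H \<in> borel_measurable M"
    and inv: "\<And>g x. \<lbrakk>g \<in> carrier G; x \<in> space M\<rbrakk> \<Longrightarrow> H (a g x) = H x"
  shows "(\<integral>\<^sup>+x. H x * indicator D x * orbit_count G a E x \<partial>M)
    = (\<integral>\<^sup>+x. H x * indicator E x * orbit_count G a D x \<partial>M)"
proof -
  let ?C = "count_space (carrier G)"
  have unfold_count: "(\<integral>\<^sup>+x. H x * indicator A x * orbit_count G a B x \<partial>M)
      = (\<integral>\<^sup>+g. \<integral>\<^sup>+x. H x * indicator A x * indicator B (a g x) \<partial>M \<partial>?C)"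
    if [measurable]: "A \<in> sets M" "B \<in> sets M" for A B
  proof -
    have "(\<integral>\<^sup>+x. H x * indicator A x * orbit_count G a B x \<partial>M)
      = (\<integral>\<^sup>+x. \<integral>\<^sup>+g. H x * indicator A x * indicator B (a g x) \<partial>?C \<partial>M)"
      unfolding orbit_count_def by (intro nn_integral_cong nn_integral_cmult[symmetric]) simp
    also have "\<dots> = (\<integral>\<^sup>+g. \<integral>\<^sup>+x. H x * indicator A x * indicator B (a g x) \<partial>M \<partial>?C)"
      using countable_group by (intro nn_integral_count_space_nn_integral) measurable
    finally show ?thesis .
  qed
  have swap: "(\<integral>\<^sup>+x. H x * indicator D x * indicator E (a g x) \<partial>M)
      = (\<integral>\<^sup>+x. H x * indicator E x * indicator D (a (inv g) x) \<partial>M)" if g: "g \<in> carrier G" for g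
  proof -
    have "(\<integral>\<^sup>+x. H x * indicator D x * indicator E (a g x) \<partial>M)
        = (\<integral>\<^sup>+x. (\<lambda>y. H y * indicator E y * indicator D (a (inv g) y)) (a g x) \<partial>M)"
      using g by (intro nn_integral_cong) (simp add: inv act_inv_act mult_ac)
    also have "\<dots> = (\<integral>\<^sup>+x. H x * indicator E x * indicator D (a (inv g) x) \<partial>M)"
    proof (rule nn_integral_act[OF _ g])
      have [measurable]: "a (inv g) \<in> measurable M M" using g by simp
      show "(\<lambda>x. H x * indicator E x * indicator D (a (inv g) x)) \<in> borel_measurable M"
        by measurable
    qed
    finally show ?thesis .
  qed
  have "bij_betw (m_inv G) (carrier G) (carrier G)"
    by (rule bij_betw_byWitness[where f' = "m_inv G"]) auto
  then have "(\<integral>\<^sup>+g. \<integral>\<^sup>+x. H x * indicator E x * indicator D (a (inv g) x) \<partial>M \<partial>?C)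
      = (\<integral>\<^sup>+g. \<integral>\<^sup>+x. H x * indicator E x * indicator D (a g x) \<partial>M \<partial>?C)"
    by (rule nn_integral_bij_count_space)
  then show ?thesis
    unfolding unfold_count[OF D E] unfold_count[OF E D]
    by (subst nn_integral_cong[OF swap]) simp_all
qed

section \<open>Return to a fundamental domain\<close>

context
  fixes D
  assumes D: "fund_domain G M a D"
begin

lemma fund_domain_sets [measurable]: "D \<in> sets M"
  using D by (simp add: fund_domain_def)

lemma ex1_return: "x \<in> space M \<Longrightarrow> \<exists>!g. g \<in> carrier G \<and> a g x \<in> D"
  using D by (simp add: fund_domain_def)

lemma return_elt_closed: "x \<in> space M \<Longrightarrow> return_elt G a D x \<in> carrier G"
  and act_return_elt: "x \<in> space M \<Longrightarrow> a (return_elt G a D x) x \<in> D"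
  using theI'[OF ex1_return] unfolding return_elt_def by blast+

lemma return_elt_eqI: "\<lbrakk>x \<in> space M; g \<in> carrier G; a g x \<in> D\<rbrakk> \<Longrightarrow> return_elt G a D x = g"
  unfolding return_elt_def by (intro the1_equality ex1_return) simp_all

lemma return_elt_on_domain: "x \<in> D \<Longrightarrow> return_elt G a D x = \<one>"
  using sets.sets_into_space[OF fund_domain_sets] by (intro return_elt_eqI) (auto simp: act_one)

lemma return_elt_act:
  assumes "g \<in> carrier G" "x \<in> space M"
  shows "return_elt G a D (a g x) = return_elt G a D x \<otimes> inv g"
proof (rule return_elt_eqI)
  show "a (return_elt G a D x \<otimes> inv g) (a g x) \<in> D"
    using assms by (simp add: act_mult return_elt_closed act_closed act_inv_act act_return_elt)
qed (simp_all add: assms return_elt_closed act_closed)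

lemma orbit_count_fund_domain:
  assumes "x \<in> space M"
  shows "orbit_count G a D x = 1"
proof -
  have "orbit_count G a D x = (\<integral>\<^sup>+g. indicator {return_elt G a D x} g \<partial>count_space (carrier G))"
    unfolding orbit_count_def
  proof (rule nn_integral_cong)
    fix g assume "g \<in> space (count_space (carrier G))"
    then have "a g x \<in> D \<longleftrightarrow> g = return_elt G a D x"
      using return_elt_eqI[OF assms, of g] act_return_elt[OF assms] by (metis space_count_space)
    then show "indicator D (a g x) = (indicator {return_elt G a D x} g :: ennreal)"
      by (simp add: indicator_def)
  qed
  then show ?thesis using return_elt_closed[OF assms] by simp
qed

lemma return_elt_measurable [measurable]:
  "return_elt G a D \<in> measurable M (count_space (carrier G))"
proof -
  have "return_elt G a D -` {g} \<inter> space M \<in> sets M" if g: "g \<in> carrier G" for g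
  proof -
    have "return_elt G a D -` {g} \<inter> space M = a g -` D \<inter> space M"
      using return_elt_eqI[OF _ g] act_return_elt by blast
    then show ?thesis using g by (simp add: measurable_sets)
  qed
  then show ?thesis
    using return_elt_closed by (simp add: measurable_count_space_eq_countable[OF countable_group])
qed

lemma return_map_measurable [measurable]:
  "(\<lambda>x. a (return_elt G a D x) x) \<in> measurable M M"
  using act_measurable return_elt_measurable countable_group
  by (rule measurable_compose_countable')

text \<open>Any function composed with the return map is therefore invariant, as
  \<open>nn_integral_fund_domains_eq\<close> requires.\<close>

lemma return_map_act:
  assumes "g \<in> carrier G" "x \<in> space M"
  shows "a (return_elt G a D (a g x)) (a g x) = a (return_elt G a D x) x"
  using assms by (simp add: return_elt_act act_mult return_elt_closed act_closed act_inv_act)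

end

text \<open>Orbit counts of a fundamental domain are identically 1, and mass transport between
  \<open>D\<close> and \<open>E\<close> then becomes this equality.\<close>

lemma nn_integral_fund_domains_eq:
  assumes "fund_domain G M a D" "fund_domain G M a E" "H \<in> borel_measurable M"
    and "\<And>g x. \<lbrakk>g \<in> carrier G; x \<in> space M\<rbrakk> \<Longrightarrow> H (a g x) = H x"
  shows "(\<integral>\<^sup>+x\<in>D. H x \<partial>M) = (\<integral>\<^sup>+x\<in>E. H x \<partial>M)"
proof -
  have count_one: "(\<integral>\<^sup>+x. H x * indicator A x * orbit_count G a B x \<partial>M) = (\<integral>\<^sup>+x\<in>A. H x \<partial>M)"
    if "fund_domain G M a B" for A B
    by (intro nn_integral_cong) (simp add: orbit_count_fund_domain[OF that])
  show ?thesis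
    using mass_transport[of D E H] assms count_one fund_domain_sets by simp
qed

end

section \<open>Couplings\<close>

locale coupled_actions =
  G: countable_mp_action G M aG + L: countable_mp_action L M aL
  for G :: "('g, 'b) monoid_scheme" and L :: "('l, 'c) monoid_scheme"
    and M :: "'w measure" and aG aL +
  fixes XG XL
  assumes commute: "\<lbrakk>g \<in> carrier G; l \<in> carrier L; x \<in> space M\<rbrakk> \<Longrightarrow> aG g (aL l x) = aL l (aG g x)"
    and XG: "fund_domain G M aG XG" and XL: "fund_domain L M aL XL"
    and XL_pos: "0 < emeasure M XL"
begin

section \<open>The cocycle and the induced action\<close>

abbreviation cocycle :: "'g \<Rightarrow> 'w \<Rightarrow> 'l" where
  "cocycle \<equiv> me_cocycle L aG aL XL"

text \<open>On \<open>XL\<close> this is the dot action of \<open>G\<close> through which the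
  cocycle is defined.\<close>

definition induced :: "'g \<Rightarrow> 'w \<Rightarrow> 'w" where
  "induced g x = aL (cocycle g x) (aG g x)"

lemma cocycle_eq_return_elt: "cocycle g x = return_elt L aL XL (aG g x)"
  by (simp add: me_cocycle_def return_elt_def)

lemma XG_sets [measurable]: "XG \<in> sets M" and XL_sets [measurable]: "XL \<in> sets M"
  using G.fund_domain_sets[OF XG] L.fund_domain_sets[OF XL] by auto

lemma XL_finite: "emeasure M XL < \<infinity>"
  using XL unfolding fund_domain_def by (metis infinity_ennreal_def)

lemma XL_emeasure: "emeasure M XL = ennreal (measure M XL)"
  using XL_finite by (intro emeasure_eq_ennreal_measure) simp

lemma XL_measure_pos: "0 < measure M XL"
  using XL_pos XL_emeasure by simp

lemma XL_space: "x \<in> XL \<Longrightarrow> x \<in> space M"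
  using sets.sets_into_space[OF XL_sets] by blast

lemma subset_XL_emeasure:
  assumes "A \<subseteq> XL" "A \<in> sets M"
  shows "emeasure M A = ennreal (measure M A)"
proof -
  have "emeasure M A < \<infinity>"
    using emeasure_mono[OF assms(1) XL_sets] XL_finite by (rule le_less_trans)
  then show ?thesis by (intro emeasure_eq_ennreal_measure) simp
qed

lemma cocycle_closed: "\<lbrakk>g \<in> carrier G; x \<in> space M\<rbrakk> \<Longrightarrow> cocycle g x \<in> carrier L"
  by (simp add: cocycle_eq_return_elt L.return_elt_closed[OF XL] G.act_closed)

lemma induced_in_XL: "\<lbrakk>g \<in> carrier G; x \<in> space M\<rbrakk> \<Longrightarrow> induced g x \<in> XL"
  by (simp add: induced_def cocycle_eq_return_elt L.act_return_elt[OF XL] G.act_closed)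

lemma cocycle_measurable [measurable]:
  assumes [measurable]: "g \<in> carrier G"
  shows "cocycle g \<in> measurable M (count_space (carrier L))"
  unfolding cocycle_eq_return_elt[abs_def]
  using measurable_compose[OF G.act_measurable[OF assms] L.return_elt_measurable[OF XL]] .

lemma cocycle_function_measurable:
  assumes "g \<in> carrier G"
  shows "(\<lambda>x. h (cocycle g x)) \<in> measurable M (count_space UNIV)"
  using measurable_compose[OF cocycle_measurable[OF assms], of h "count_space UNIV"] by simp

lemma induced_measurable [measurable]:
  assumes "g \<in> carrier G"
  shows "induced g \<in> measurable M M"
  unfolding induced_def cocycle_eq_return_elt
  using measurable_compose[OF G.act_measurable[OF assms] L.return_map_measurable[OF XL]] .

text \<open>As the actions commute, moving \<open>induced h x\<close> by \<open>g\<close> gives the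
  translate by \<open>cocycle h x\<close> of the point \<open>x\<close> moved by the product.
  Translating a point by \<open>l\<close> multiplies its return element on the right by the inverse
  of \<open>l\<close>.\<close>

lemma cocycle_mult:
  assumes "g \<in> carrier G" "h \<in> carrier G" "x \<in> space M"
  shows "cocycle (g \<otimes>\<^bsub>G\<^esub> h) x = cocycle g (induced h x) \<otimes>\<^bsub>L\<^esub> cocycle h x"
proof -
  let ?l = "cocycle h x"
  have l: "?l \<in> carrier L" using assms cocycle_closed by simp
  have "cocycle g (induced h x) = return_elt L aL XL (aL ?l (aG (g \<otimes>\<^bsub>G\<^esub> h) x))"
    using assms l by (simp add: induced_def cocycle_eq_return_elt[of g] commute G.act_closed G.act_mult)
  also have "\<dots> = cocycle (g \<otimes>\<^bsub>G\<^esub> h) x \<otimes>\<^bsub>L\<^esub> inv\<^bsub>L\<^esub> ?l"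
    using assms l by (simp add: L.return_elt_act[OF XL] G.act_closed cocycle_eq_return_elt[of "g \<otimes>\<^bsub>G\<^esub> h"])
  finally show ?thesis
    using l assms cocycle_closed[of "g \<otimes>\<^bsub>G\<^esub> h" x] by (simp add: L.m_assoc)
qed

lemma cocycle_one: "x \<in> XL \<Longrightarrow> cocycle \<one>\<^bsub>G\<^esub> x = \<one>\<^bsub>L\<^esub>"
  by (simp add: cocycle_eq_return_elt G.act_one XL_space L.return_elt_on_domain[OF XL])

text \<open>By commutation, the elements returning \<open>x\<close> to the preimage are those
  returning \<open>aG g x\<close> to \<open>XL\<close>. The measure stays finite because
  \<open>aG g\<close> preserves it.\<close>

lemma fund_domain_translate:
  assumes g: "g \<in> carrier G"
  shows "fund_domain L M aL (aG g -` XL \<inter> space M)"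
proof -
  have "emeasure M (aG g -` XL \<inter> space M) = emeasure (distr M M (aG g)) XL"
    using g by (simp add: emeasure_distr)
  also have "\<dots> < \<infinity>" using G.act_distr[OF g] XL_finite by simp
  finally have fin: "emeasure M (aG g -` XL \<inter> space M) < Orderings.top" by simp
  have eq: "(l \<in> carrier L \<and> aL l x \<in> aG g -` XL \<inter> space M) = (l \<in> carrier L \<and> aL l (aG g x) \<in> XL)"
    if "x \<in> space M" for l x
    using that g by (auto simp: commute L.act_closed)
  show ?thesis
    unfolding fund_domain_def
  proof (intro conjI ballI)
    show "aG g -` XL \<inter> space M \<in> sets M" using g by (intro measurable_sets[OF _ XL_sets]) simp
    show "\<exists>!l. l \<in> carrier L \<and> aL l x \<in> aG g -` XL \<inter> space M" if "x \<in> space M" for x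
      unfolding eq[OF that] using L.ex1_return[OF XL] that g G.act_closed by simp
  qed (rule fin)
qed

text \<open>The induced action preserves the measure on \<open>XL\<close>. Substituting along
  \<open>aG g\<close> yields the integral of \<open>H\<close> over the translate \<open>?Y\<close>
  of \<open>XL\<close>. Since \<open>?Y\<close> is again a fundamental domain for \<open>L\<close>
  and \<open>H\<close> is constant on \<open>L\<close>-orbits, \<open>?Y\<close> can be replaced by
  \<open>XL\<close>, where \<open>H\<close> agrees with \<open>F\<close>.\<close>

lemma nn_integral_induced:
  assumes g: "g \<in> carrier G" and F: "F \<in> borel_measurable M"
  shows "(\<integral>\<^sup>+x\<in>XL. F (induced g x) \<partial>M) = (\<integral>\<^sup>+x\<in>XL. F x \<partial>M)"
proof -
  define H where "H y = F (aL (return_elt L aL XL y) y)" for y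
  have H [measurable]: "H \<in> borel_measurable M"
    unfolding H_def using measurable_compose[OF L.return_map_measurable[OF XL] F] .
  let ?Y = "aG (inv\<^bsub>G\<^esub> g) -` XL \<inter> space M"
  have ig: "inv\<^bsub>G\<^esub> g \<in> carrier G" using g by simp
  have Y [measurable]: "?Y \<in> sets M" using ig by (simp add: measurable_sets)
  have "(\<integral>\<^sup>+x\<in>XL. F (induced g x) \<partial>M) = (\<integral>\<^sup>+x. (\<lambda>y. H y * indicator ?Y y) (aG g x) \<partial>M)"
    using g by (intro nn_integral_cong)
      (simp add: H_def induced_def cocycle_eq_return_elt indicator_def G.act_closed G.act_inv_act)
  also have "\<dots> = (\<integral>\<^sup>+y\<in>?Y. H y \<partial>M)"
    by (rule G.nn_integral_act[OF _ g]) measurable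
  also have "\<dots> = (\<integral>\<^sup>+y\<in>XL. H y \<partial>M)"
    by (rule L.nn_integral_fund_domains_eq[OF fund_domain_translate[OF ig] XL H])
      (simp add: H_def L.return_map_act[OF XL])
  also have "\<dots> = (\<integral>\<^sup>+y\<in>XL. F y \<partial>M)"
    by (intro nn_integral_cong)
      (simp add: H_def L.return_elt_on_domain[OF XL] L.act_one split: split_indicator)
  finally show ?thesis .
qed

text \<open>Induction along a word whose last letter acts first: the cocycle identity and
  subadditivity split off that letter, and invariance of the measure removes
  \<open>induced s\<close> from the remaining term. The function \<open>\<theta>\<close> will be a
  truncated, rescaled length.\<close>

lemma nn_integral_cocycle_word_length_le:
  fixes \<theta> :: "nat \<Rightarrow> ennreal"
  assumes S: "SG \<subseteq> carrier G" and SL: "fin_gen_set L SL"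
    and \<theta>: "\<And>m n. m \<le> n \<Longrightarrow> \<theta> m \<le> \<theta> n" "\<And>m n. \<theta> (m + n) \<le> \<theta> m + \<theta> n" "\<theta> 0 = 0"
    and B: "\<And>s. s \<in> SG \<union> m_inv G ` SG \<union> {\<one>\<^bsub>G\<^esub>} \<Longrightarrow>
      (\<integral>\<^sup>+x\<in>XL. \<theta> (word_length L SL (cocycle s x)) \<partial>M) \<le> B"
    and g: "g \<in> word_ball G SG n"
  shows "(\<integral>\<^sup>+x\<in>XL. \<theta> (word_length L SL (cocycle g x)) \<partial>M) \<le> of_nat n * B"
  using g
proof (induction n arbitrary: g)
  case 0
  have "(\<integral>\<^sup>+x\<in>XL. \<theta> (word_length L SL (cocycle g x)) \<partial>M) = (\<integral>\<^sup>+x. 0 \<partial>M)"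
    using 0 by (intro nn_integral_cong) (simp add: cocycle_one \<theta> split: split_indicator)
  then show ?case by simp
next
  case (Suc n)
  then obtain h s where hs: "g = h \<otimes>\<^bsub>G\<^esub> s" "h \<in> word_ball G SG n"
    "s \<in> SG \<union> m_inv G ` SG \<union> {\<one>\<^bsub>G\<^esub>}" by auto
  have h: "h \<in> carrier G" using hs(2) G.word_ball_subset_carrier[OF S] by blast
  have s: "s \<in> carrier G" using hs(3) G.symmetrised_closed[OF S] by blast
  define \<Theta> where "\<Theta> k x = \<theta> (word_length L SL (cocycle k x))" for k x
  have \<Theta> [measurable]: "\<Theta> k \<in> borel_measurable M" if "k \<in> carrier G" for k
    using measurable_compose[OF cocycle_measurable[OF that],
        of "\<lambda>l. \<theta> (word_length L SL l)" borel] by (simp add: \<Theta>_def[abs_def])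
  have "\<Theta> g x \<le> \<Theta> h (induced s x) + \<Theta> s x" if x: "x \<in> space M" for x
  proof -
    have "word_length L SL (cocycle g x)
        \<le> word_length L SL (cocycle h (induced s x)) + word_length L SL (cocycle s x)"
      unfolding hs(1) cocycle_mult[OF h s x]
      using h s x XL_space[OF induced_in_XL[OF s x]]
      by (intro L.word_length_mult_le[OF SL] cocycle_closed)
    then show ?thesis unfolding \<Theta>_def using \<theta>(1,2) order_trans by blast
  qed
  then have "(\<integral>\<^sup>+x\<in>XL. \<Theta> g x \<partial>M) \<le> (\<integral>\<^sup>+x. \<Theta> h (induced s x) * indicator XL x + \<Theta> s x * indicator XL x \<partial>M)"
    by (intro nn_integral_mono) (simp split: split_indicator)
  also have "\<dots> = (\<integral>\<^sup>+x\<in>XL. \<Theta> h (induced s x) \<partial>M) + (\<integral>\<^sup>+x\<in>XL. \<Theta> s x \<partial>M)"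
    using measurable_compose[OF induced_measurable[OF s] \<Theta>[OF h]] \<Theta>[OF s]
    by (intro nn_integral_add borel_measurable_times_ennreal borel_measurable_indicator) auto
  also have "\<dots> = (\<integral>\<^sup>+x\<in>XL. \<Theta> h x \<partial>M) + (\<integral>\<^sup>+x\<in>XL. \<Theta> s x \<partial>M)"
    using nn_integral_induced[OF s \<Theta>[OF h]] by simp
  also have "\<dots> \<le> of_nat n * B + B"
    using Suc.IH[OF hs(2)] B[OF hs(3)] unfolding \<Theta>_def by (rule add_mono)
  also have "\<dots> = of_nat (Suc n) * B" by (simp add: distrib_right add.commute)
  finally show ?case unfolding \<Theta>_def .
qed

section \<open>Finite orbit counts and the counting argument\<close>

lemma AE_orbit_count_finite: "AE x in M. x \<in> XL \<longrightarrow> orbit_count G aG XL x \<noteq> \<infinity>"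
proof -
  let ?N = "orbit_count G aG XL"
  have N [measurable]: "?N \<in> borel_measurable M" by (rule G.orbit_count_measurable) simp
  have inv: "?N (aG g x) = ?N x" if g: "g \<in> carrier G" and x: "x \<in> space M" for g x
  proof -
    have bij: "bij_betw (\<lambda>h. h \<otimes>\<^bsub>G\<^esub> g) (carrier G) (carrier G)"
      using g by (intro bij_betw_byWitness[where f' = "\<lambda>h. h \<otimes>\<^bsub>G\<^esub> inv\<^bsub>G\<^esub> g"]) (auto simp: G.m_assoc)
    have "?N (aG g x) = (\<integral>\<^sup>+h. (\<lambda>k. indicator XL (aG k x)) (h \<otimes>\<^bsub>G\<^esub> g) \<partial>count_space (carrier G))"
      unfolding orbit_count_def using g x by (intro nn_integral_cong) (simp add: G.act_mult)
    also have "\<dots> = ?N x" unfolding orbit_count_def by (rule nn_integral_bij_count_space[OF bij])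
    finally show ?thesis .
  qed
  \<comment> \<open>With weight 1, transport equates the integral of the count over
    \<open>XG\<close> with the finite measure of \<open>XL\<close>; hence the count is almost
    everywhere finite on \<open>XG\<close>.\<close>
  have "(\<integral>\<^sup>+x. 1 * indicator XG x * ?N x \<partial>M) = (\<integral>\<^sup>+x. 1 * indicator XL x * orbit_count G aG XG x \<partial>M)"
    by (rule G.mass_transport) simp_all
  also have "\<dots> = (\<integral>\<^sup>+x. indicator XL x \<partial>M)"
    by (intro nn_integral_cong) (simp add: G.orbit_count_fund_domain[OF XG])
  also have "\<dots> < \<infinity>" using XL_finite by simp
  finally have "(\<integral>\<^sup>+x. indicator XG x * ?N x \<partial>M) \<noteq> \<infinity>" by simp
  then have AE_XG: "AE x in M. indicator XG x * ?N x \<noteq> \<infinity>"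
    by (intro nn_integral_PInf_AE) measurable
  define B where "B = {x \<in> space M. ?N x = \<infinity>}"
  have B [measurable]: "B \<in> sets M" unfolding B_def by measurable
  \<comment> \<open>The invariant set \<open>B\<close> meets \<open>XG\<close> in a null set;
    transport weighted by its indicator shows that it meets \<open>XL\<close> in a null set
    too.\<close>
  have "(\<integral>\<^sup>+x. indicator B x * indicator XL x * orbit_count G aG XG x \<partial>M)
      = (\<integral>\<^sup>+x. indicator B x * indicator XG x * ?N x \<partial>M)"
    by (rule G.mass_transport) (auto simp: B_def inv G.act_closed indicator_def)
  also have "\<dots> = (\<integral>\<^sup>+x. 0 \<partial>M)"
    using AE_XG by (intro nn_integral_cong_AE) (auto simp: B_def split: split_indicator)
  finally have "(\<integral>\<^sup>+x. indicator (B \<inter> XL) x * orbit_count G aG XG x \<partial>M) = 0"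
    by (simp add: indicator_inter_arith)
  moreover have "(\<integral>\<^sup>+x. indicator (B \<inter> XL) x * orbit_count G aG XG x \<partial>M) = (\<integral>\<^sup>+x. indicator (B \<inter> XL) x \<partial>M)"
    by (intro nn_integral_cong) (simp add: G.orbit_count_fund_domain[OF XG])
  ultimately have "emeasure M (B \<inter> XL) = 0" by simp
  then have "AE x in M. x \<notin> B \<inter> XL" by (intro AE_not_in) auto
  then show ?thesis by (rule AE_mp) (auto simp: B_def)
qed

text \<open>The sublevel sets of the count exhaust \<open>XL\<close> up to a null set, and half of
  the finite positive measure of \<open>XL\<close> is strictly below their limiting measure.\<close>

lemma ex_bounded_orbit_count:
  obtains K :: nat where "measure M XL / 2 \<le> measure M {x \<in> XL. orbit_count G aG XL x \<le> of_nat K}"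
proof -
  let ?N = "orbit_count G aG XL"
  have N [measurable]: "?N \<in> borel_measurable M" by (rule G.orbit_count_measurable) simp
  define A where "A k = {x \<in> XL. ?N x \<le> of_nat k}" for k :: nat
  have A_eq: "A k = XL \<inter> {x \<in> space M. ?N x \<le> of_nat k}" for k
    using XL_space by (auto simp: A_def)
  have A [measurable]: "A k \<in> sets M" for k unfolding A_eq by measurable
  have "incseq A"
  proof (rule incseq_SucI, rule subsetI)
    fix k x assume "x \<in> A k"
    moreover have "(of_nat k :: ennreal) \<le> of_nat (Suc k)" by (rule of_nat_mono) simp
    ultimately show "x \<in> A (Suc k)" unfolding A_def using order_trans by blast
  qed
  then have "(\<lambda>k. emeasure M (A k)) \<longlonglongrightarrow> emeasure M (\<Union>k. A k)"
    by (intro Lim_emeasure_incseq) auto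
  also have "emeasure M (\<Union>k. A k) = emeasure M XL"
  proof (rule emeasure_eq_AE)
    show "AE x in M. x \<in> (\<Union>k. A k) \<longleftrightarrow> x \<in> XL"
      using AE_orbit_count_finite
    proof eventually_elim
      case (elim x)
      have "\<exists>k. ?N x \<le> of_nat k" if "?N x \<noteq> \<infinity>"
      proof -
        have "?N x < Orderings.top" using that less_top[of "?N x"] by simp
        then show ?thesis using ennreal_Ex_less_of_nat less_imp_le by blast
      qed
      then show ?case using elim by (auto simp: A_def)
    qed
  qed auto
  finally have "(\<lambda>k. emeasure M (A k)) \<longlonglongrightarrow> ennreal (measure M XL)"
    by (simp add: XL_emeasure)
  moreover have "ennreal (measure M XL / 2) < ennreal (measure M XL)"
    using XL_measure_pos by (simp add: ennreal_less_iff)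
  ultimately have "\<forall>\<^sub>F k in sequentially. ennreal (measure M XL / 2) < emeasure M (A k)"
    by (rule order_tendstoD)
  then obtain k where "ennreal (measure M XL / 2) < emeasure M (A k)"
    by (auto simp: eventually_sequentially)
  moreover have "emeasure M (A k) = ennreal (measure M (A k))"
    by (rule subset_XL_emeasure) (auto simp: A_def)
  ultimately have "measure M XL / 2 \<le> measure M (A k)"
    by (simp add: ennreal_less_iff)
  then show ?thesis using that unfolding A_def by blast
qed

text \<open>Sort the elements \<open>g\<close> by cocycle value. Two elements with the same value
  differ by an element of \<open>G\<close> that moves one induced point to the other inside
  \<open>XL\<close>, so each value occurs at most \<open>K\<close> times; the possible values lie in
  a ball of \<open>L\<close>.\<close>

lemma card_return_le:
  assumes SL: "fin_gen_set L SL" and F: "finite F" "F \<subseteq> carrier G" and x: "x \<in> space M"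
  shows "card {g \<in> F. word_length L SL (cocycle g x) \<le> m \<and> orbit_count G aG XL (induced g x) \<le> of_nat K}
    \<le> K * card (word_ball L SL m)"
proof -
  let ?fibre = "\<lambda>l. {g \<in> F. cocycle g x = l \<and> orbit_count G aG XL (induced g x) \<le> of_nat K}"
  have fibre: "card (?fibre l) \<le> K" for l
  proof (cases "?fibre l = {}")
    case False
    then obtain g0 where g0: "g0 \<in> F" "cocycle g0 x = l" "orbit_count G aG XL (induced g0 x) \<le> of_nat K"
      by blast
    have g0c: "g0 \<in> carrier G" using g0 F by blast
    define y where "y = induced g0 x"
    have y: "y \<in> space M" using induced_in_XL[OF g0c x] XL_space by (simp add: y_def)
    have lc: "l \<in> carrier L" using cocycle_closed[OF g0c x] g0 by simp
    define Q where "Q = {h \<in> carrier G. aG h y \<in> XL}"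
    have "orbit_count G aG XL y = (\<integral>\<^sup>+h. indicator Q h \<partial>count_space (carrier G))"
      unfolding orbit_count_def by (intro nn_integral_cong) (auto simp: Q_def split: split_indicator)
    also have "\<dots> = emeasure (count_space (carrier G)) Q"
      by (simp add: Q_def)
    finally have Q: "emeasure (count_space (carrier G)) Q \<le> of_nat K" using g0 by (simp add: y_def)
    have Qsub: "Q \<subseteq> carrier G" by (auto simp: Q_def)
    have finQ: "finite Q"
      using Q Qsub by (cases "finite Q") (auto simp: emeasure_count_space_infinite top_unique)
    then have cardQ: "card Q \<le> K" using Q Qsub by (simp add: emeasure_count_space_finite)
    have "g \<in> (\<lambda>h. h \<otimes>\<^bsub>G\<^esub> g0) ` Q" if g: "g \<in> ?fibre l" for g
    proof
      have gc: "g \<in> carrier G" using g F by auto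
      then show "g = (g \<otimes>\<^bsub>G\<^esub> inv\<^bsub>G\<^esub> g0) \<otimes>\<^bsub>G\<^esub> g0" using g0c by (simp add: G.m_assoc)
      \<comment> \<open>The common value \<open>l\<close> passes through the commuting action, so
        \<open>G\<close> alone moves \<open>y\<close> to \<open>induced g x\<close>.\<close>
      have "aG (g \<otimes>\<^bsub>G\<^esub> inv\<^bsub>G\<^esub> g0) y = aL l (aG (g \<otimes>\<^bsub>G\<^esub> inv\<^bsub>G\<^esub> g0) (aG g0 x))"
        using gc g0c x lc g0 by (simp add: y_def induced_def commute G.act_closed)
      also have "\<dots> = induced g x"
        using gc g0c x g by (simp add: induced_def G.act_mult G.act_closed G.act_inv_act)
      finally show "g \<otimes>\<^bsub>G\<^esub> inv\<^bsub>G\<^esub> g0 \<in> Q"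
        using gc g0c induced_in_XL[OF gc x] by (simp add: Q_def)
    qed
    then have "card (?fibre l) \<le> card ((\<lambda>h. h \<otimes>\<^bsub>G\<^esub> g0) ` Q)"
      using finQ by (intro card_mono) auto
    also have "\<dots> \<le> K" using card_image_le[OF finQ] cardQ order_trans by blast
    finally show ?thesis .
  qed (simp only: card.empty)
  have finB: "finite (word_ball L SL m)" using SL L.finite_word_ball by (simp add: fin_gen_set_def)
  have "{g \<in> F. word_length L SL (cocycle g x) \<le> m \<and> orbit_count G aG XL (induced g x) \<le> of_nat K}
      \<subseteq> (\<Union>l\<in>word_ball L SL m. ?fibre l)"
  proof
    fix g assume g: "g \<in> {g \<in> F. word_length L SL (cocycle g x) \<le> m \<and> orbit_count G aG XL (induced g x) \<le> of_nat K}"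
    then have "cocycle g x \<in> word_ball L SL m"
      using L.in_word_ball_iff[OF SL cocycle_closed[OF _ x]] F by auto
    with g show "g \<in> (\<Union>l\<in>word_ball L SL m. ?fibre l)" by auto
  qed
  then have "card {g \<in> F. word_length L SL (cocycle g x) \<le> m \<and> orbit_count G aG XL (induced g x) \<le> of_nat K}
      \<le> card (\<Union>l\<in>word_ball L SL m. ?fibre l)"
    using finB F by (intro card_mono) auto
  also have "\<dots> \<le> (\<Sum>l\<in>word_ball L SL m. card (?fibre l))" by (rule card_UN_le[OF finB])
  also have "\<dots> \<le> (\<Sum>l\<in>word_ball L SL m. K)" by (intro sum_mono fibre)
  finally show ?thesis by (simp add: mult.commute)
qed

text \<open>Double counting of the pairs of \<open>g\<close> in \<open>F\<close> and
  \<open>x\<close> in \<open>P g\<close>: each \<open>g\<close> contributes at least a quarter of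
  the measure of \<open>XL\<close>, while each \<open>x\<close> lies in a number of sets bounded by
  \<open>card_return_le\<close>.\<close>

lemma card_le_word_ball:
  assumes K: "measure M XL / 2 \<le> measure M {x \<in> XL. orbit_count G aG XL x \<le> of_nat K}"
    and SL: "fin_gen_set L SL" and F: "finite F" "F \<subseteq> carrier G"
    and far: "\<And>g. g \<in> F \<Longrightarrow> measure M {x \<in> XL. m < word_length L SL (cocycle g x)} \<le> measure M XL / 4"
  shows "real (card F) \<le> 4 * real K * real (card (word_ball L SL m))"
proof -
  let ?N = "orbit_count G aG XL"
  have N [measurable]: "?N \<in> borel_measurable M" by (rule G.orbit_count_measurable) simp
  define A where "A = {x \<in> space M. ?N x \<le> of_nat K}"
  have A [measurable]: "A \<in> sets M" unfolding A_def by measurable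
  have A_XL: "{x \<in> XL. ?N x \<le> of_nat K} = A \<inter> XL" using XL_space by (auto simp: A_def)
  define P where "P g = {x \<in> XL. word_length L SL (cocycle g x) \<le> m \<and> ?N (induced g x) \<le> of_nat K}" for g
  define Z where "Z g = {x \<in> XL. m < word_length L SL (cocycle g x)}" for g
  have P [measurable]: "P g \<in> sets M" and Z [measurable]: "Z g \<in> sets M" if g: "g \<in> carrier G" for g
  proof -
    have [measurable]: "(\<lambda>x. word_length L SL (cocycle g x)) \<in> measurable M (count_space UNIV)"
      by (rule cocycle_function_measurable[OF g])
    have [measurable]: "(\<lambda>x. ?N (induced g x)) \<in> borel_measurable M"
      using measurable_compose[OF induced_measurable[OF g] N] .
    have "P g = XL \<inter> {x \<in> space M. word_length L SL (cocycle g x) \<le> m \<and> ?N (induced g x) \<le> of_nat K}"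
      using XL_space by (auto simp: P_def)
    then show "P g \<in> sets M" by simp
    have "Z g = XL \<inter> {x \<in> space M. m < word_length L SL (cocycle g x)}"
      using XL_space by (auto simp: Z_def)
    then show "Z g \<in> sets M" by simp
  qed
  \<comment> \<open>By invariance, \<open>induced g\<close> lands in the set of bounded count with
    measure at least one half of that of \<open>XL\<close>; the far set \<open>Z g\<close> removes
    at most a quarter.\<close>
  have P_large: "measure M XL / 4 \<le> measure M (P g)" if gF: "g \<in> F" for g
  proof -
    have g: "g \<in> carrier G" using gF F by blast
    have "emeasure M (A \<inter> XL) = (\<integral>\<^sup>+x\<in>XL. indicator A x \<partial>M)"
      by (simp add: indicator_inter_arith[symmetric])
    also have "\<dots> = (\<integral>\<^sup>+x\<in>XL. indicator A (induced g x) \<partial>M)"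
      by (rule nn_integral_induced[OF g, symmetric]) simp
    also have "\<dots> \<le> (\<integral>\<^sup>+x. indicator (P g) x + indicator (Z g) x \<partial>M)"
      by (intro nn_integral_mono) (auto simp: A_def P_def Z_def split: split_indicator)
    also have "\<dots> = emeasure M (P g) + emeasure M (Z g)"
      using P[OF g] Z[OF g] by (subst nn_integral_add) auto
    also have "\<dots> = ennreal (measure M (P g) + measure M (Z g))"
      using subset_XL_emeasure[of "P g"] subset_XL_emeasure[of "Z g"] P[OF g] Z[OF g]
      by (simp add: P_def Z_def)
    also have "emeasure M (A \<inter> XL) = ennreal (measure M (A \<inter> XL))"
      by (rule subset_XL_emeasure) auto
    finally have "measure M (A \<inter> XL) \<le> measure M (P g) + measure M (Z g)"
      by (simp add: ennreal_le_iff del: ennreal_plus)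
    then show ?thesis using K far[OF gF] by (simp add: A_XL Z_def[symmetric])
  qed
  have "ennreal (\<Sum>g\<in>F. measure M (P g)) = (\<Sum>g\<in>F. emeasure M (P g))"
  proof -
    have "emeasure M (P g) = ennreal (measure M (P g))" if "g \<in> F" for g
      using that F by (intro subset_XL_emeasure P) (auto simp: P_def)
    then show ?thesis by (simp add: sum_ennreal)
  qed
  also have "\<dots> = (\<integral>\<^sup>+x. (\<Sum>g\<in>F. indicator (P g) x) \<partial>M)"
    using F P by (subst nn_integral_sum) (auto intro!: sum.cong)
  also have "\<dots> \<le> (\<integral>\<^sup>+x. of_nat (K * card (word_ball L SL m)) * indicator XL x \<partial>M)"
  proof (intro nn_integral_mono)
    fix x assume x: "x \<in> space M"
    show "(\<Sum>g\<in>F. indicator (P g) x) \<le> (of_nat (K * card (word_ball L SL m)) * indicator XL x :: ennreal)"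
    proof (cases "x \<in> XL")
      case True
      have "(\<Sum>g\<in>F. indicator (P g) x) = (of_nat (card {g \<in> F. x \<in> P g}) :: ennreal)"
        using F by (simp add: indicator_def sum.If_cases Int_def)
      also have "{g \<in> F. x \<in> P g} = {g \<in> F. word_length L SL (cocycle g x) \<le> m \<and> ?N (induced g x) \<le> of_nat K}"
        using True by (auto simp: P_def)
      finally show ?thesis using card_return_le[OF SL F x, of m K] True
        by (simp del: of_nat_mult)
    qed (simp add: P_def)
  qed
  also have "\<dots> = of_nat (K * card (word_ball L SL m)) * emeasure M XL"
    by (rule nn_integral_cmult_indicator) simp
  also have "\<dots> = ennreal (real K * real (card (word_ball L SL m)) * measure M XL)"
    unfolding XL_emeasure by (simp add: ennreal_of_nat_eq_real_of_nat ennreal_mult)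
  finally have "(\<Sum>g\<in>F. measure M (P g)) \<le> real K * real (card (word_ball L SL m)) * measure M XL"
    by (simp add: ennreal_le_iff)
  moreover have "real (card F) * (measure M XL / 4) \<le> (\<Sum>g\<in>F. measure M (P g))"
    using sum_mono[of F "\<lambda>_. measure M XL / 4" "\<lambda>g. measure M (P g)"] P_large by simp
  ultimately have "real (card F) * measure M XL \<le> (4 * real K * real (card (word_ball L SL m))) * measure M XL"
    by simp
  then show ?thesis using XL_measure_pos by (simp add: mult_le_cancel_right)
qed

end

section \<open>Inverse growth functions\<close>

context
  fixes f :: "real \<Rightarrow> real" and b :: real
  assumes f: "strict_mono_on {0..} f" and b: "{b..} \<subseteq> f ` {0..}"
begin

lemma finv_of: "0 \<le> x \<Longrightarrow> finv f (f x) = x"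
  unfolding finv_def using strict_mono_on_imp_inj_on[OF f] by (intro inv_into_f_f) auto

text \<open>Below \<open>b\<close> a value may fail to be attained, and \<open>inv_into\<close> then
  returns an arbitrary element; this explains the threshold in the facts that follow.\<close>

lemma of_finv: "b \<le> y \<Longrightarrow> f (finv f y) = y"
  unfolding finv_def using b by (intro f_inv_into_f) auto

lemma finv_nonneg: "b \<le> y \<Longrightarrow> 0 \<le> finv f y"
  using inv_into_into[of y f "{0..}"] b unfolding finv_def by auto

lemma le_finvI:
  assumes "0 \<le> x" "f x \<le> y" "b \<le> y"
  shows "x \<le> finv f y"
proof (rule ccontr)
  assume "\<not> x \<le> finv f y"
  then have "f (finv f y) < f x"
    using assms finv_nonneg[of y] by (intro strict_mono_onD[OF f]) auto
  then show False using assms of_finv by simp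
qed

lemma finv_mono: "b \<le> y \<Longrightarrow> y \<le> z \<Longrightarrow> finv f y \<le> finv f z"
  by (rule le_finvI) (simp_all add: finv_nonneg of_finv)

lemma filterlim_finv_at_top: "filterlim (finv f) at_top at_top"
  unfolding filterlim_at_top
proof
  fix Z
  show "\<forall>\<^sub>F y in at_top. Z \<le> finv f y"
    using eventually_ge_at_top[of "max b (f (max 0 Z))"]
  proof eventually_elim
    case (elim y)
    then have "max 0 Z \<le> finv f y" by (intro le_finvI) auto
    then show ?case by simp
  qed
qed

text \<open>Unboundedness comes from attaining every value above \<open>b\<close>, and monotonicity
  then gives the limit.\<close>

lemma filterlim_growth_at_top: "filterlim f at_top at_top"
  unfolding filterlim_at_top
proof
  fix Z
  define x where "x = finv f (max b Z)"
  have x: "0 \<le> x" "f x = max b Z" by (simp_all add: x_def finv_nonneg of_finv)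
  show "\<forall>\<^sub>F y in at_top. Z \<le> f y"
    using eventually_ge_at_top[of x]
  proof eventually_elim
    case (elim y)
    then have "f x \<le> f y" using x by (intro strict_mono_on_leD[OF f]) auto
    then show ?case using x by simp
  qed
qed

end

lemma bigo_at_topE:
  fixes f g :: "real \<Rightarrow> real"
  assumes "f \<in> O[at_top](g)"
  obtains A where "A > 0" "\<forall>\<^sub>F x in at_top. \<bar>f x\<bar> \<le> A * \<bar>g x\<bar>"
  using landau_o.bigE[OF assms] by auto

lemma filterlim_mult_const_at_top: "0 < c \<Longrightarrow> filterlim (\<lambda>x::real. c * x) at_top at_top"
  by (simp add: filterlim_tendsto_pos_mult_at_top[OF tendsto_const _ filterlim_ident])

text \<open>If the conclusion failed, \<open>fG (n / C)\<close> would be at most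
  \<open>B * fL (C2 * c * R)\<close>. Applying \<open>finv fG\<close>, the first doubling hypothesis
  absorbs \<open>B\<close> and the second absorbs \<open>C2 * c\<close>, so \<open>n\<close> is
  bounded by a fixed multiple of \<open>\<phi>\<close> at \<open>R\<close>.\<close>

lemma growth_gap:
  fixes fG fL VG VL :: "real \<Rightarrow> real"
  assumes fG: "strict_mono_on {0..} fG" and bG: "{bG..} \<subseteq> fG ` {0..}"
    and fL: "strict_mono_on {0..} fL" and bL: "{bL..} \<subseteq> fL ` {0..}"
    and VG: "asym_le fG VG" and VL: "asym_le VL fL"
    and doubling_finv: "\<forall>C>0. (\<lambda>x. finv fG (C * x)) \<in> O[at_top](finv fG)"
    and doubling_phi: "\<forall>C>0. (\<lambda>x. finv fG (fL (C * x))) \<in> O[at_top](\<lambda>x. finv fG (fL x))"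
    and VG_nonneg: "\<And>n::nat. 0 \<le> VG (real n)"
    and K: "0 < K" and c: "0 < c"
  obtains C0 where "0 < C0"
    "\<forall>\<^sub>F R in at_top. \<forall>n::nat. C0 * finv fG (fL R) \<le> real n \<longrightarrow> K * VL (c * R) < VG (real n)"
proof -
  let ?\<phi> = "\<lambda>x. finv fG (fL x)"
  from VG obtain C A where C: "C > 0" and A: "A > 0" and "\<forall>\<^sub>F x in at_top. \<bar>fG x\<bar> \<le> A * \<bar>VG (C * x)\<bar>"
    unfolding asym_le_def by (auto elim: bigo_at_topE)
  then obtain x1 where x1: "\<And>x. x1 \<le> x \<Longrightarrow> \<bar>fG x\<bar> \<le> A * \<bar>VG (C * x)\<bar>"
    by (auto simp: eventually_at_top_linorder)
  from VL obtain C2 A2 where C2: "C2 > 0" and A2: "A2 > 0"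
    and VL2: "\<forall>\<^sub>F x in at_top. \<bar>VL x\<bar> \<le> A2 * \<bar>fL (C2 * x)\<bar>"
    unfolding asym_le_def by (auto elim: bigo_at_topE)
  define B where "B = A * K * A2"
  have B: "B > 0" using A K A2 by (simp add: B_def)
  obtain D1 where D1: "D1 > 0" and finv_B: "\<forall>\<^sub>F y in at_top. \<bar>finv fG (B * y)\<bar> \<le> D1 * \<bar>finv fG y\<bar>"
    using doubling_finv B by (auto elim: bigo_at_topE)
  have cc: "0 < C2 * c" using C2 c by simp
  obtain D2 where D2: "D2 > 0" and phi_scale: "\<forall>\<^sub>F x in at_top. \<bar>?\<phi> ((C2 * c) * x)\<bar> \<le> D2 * \<bar>?\<phi> x\<bar>"
    using doubling_phi cc by (auto elim!: bigo_at_topE)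
  \<comment> \<open>The added 1 makes the final comparison strict and gives \<open>C0\<close> at
    least 1, which pushes \<open>n / C\<close> beyond the threshold \<open>x1\<close>.\<close>
  define C0 where "C0 = C * D1 * D2 + 1"
  have C0: "1 \<le> C0" using C D1 D2 by (simp add: C0_def)
  have fL_top: "filterlim (\<lambda>R. fL ((C2 * c) * R)) at_top at_top"
    by (rule filterlim_compose[OF filterlim_growth_at_top[OF fL bL] filterlim_mult_const_at_top[OF cc]])
  have phi_top: "filterlim ?\<phi> at_top at_top"
    by (rule filterlim_compose[OF filterlim_finv_at_top[OF fG bG] filterlim_growth_at_top[OF fL bL]])
  have e1: "\<forall>\<^sub>F R in at_top. max 1 (x1 * C) \<le> ?\<phi> R"
    using phi_top unfolding filterlim_at_top by blast
  have e2: "\<forall>\<^sub>F R in at_top. \<bar>VL (c * R)\<bar> \<le> A2 * \<bar>fL (C2 * (c * R))\<bar>"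
    using eventually_compose_filterlim[OF VL2 filterlim_mult_const_at_top[OF c]] .
  have e3: "\<forall>\<^sub>F R in at_top. \<bar>finv fG (B * fL ((C2 * c) * R))\<bar> \<le> D1 * \<bar>?\<phi> ((C2 * c) * R)\<bar>"
    using eventually_compose_filterlim[OF finv_B fL_top] .
  \<comment> \<open>This bound removes the absolute value around \<open>fL\<close> and keeps
    \<open>B * fL\<close> above \<open>bG\<close>, where \<open>finv fG\<close> is a true
    inverse.\<close>
  have e5: "\<forall>\<^sub>F R in at_top. max 0 (bG / B) \<le> fL ((C2 * c) * R)"
    using fL_top unfolding filterlim_at_top by blast
  have "\<forall>\<^sub>F R in at_top. \<forall>n::nat. C0 * ?\<phi> R \<le> real n \<longrightarrow> K * VL (c * R) < VG (real n)"
    using e1 e2 e3 phi_scale e5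
  proof eventually_elim
    case (elim R)
    show ?case
    proof (intro allI impI, rule ccontr)
      fix n :: nat
      assume n: "C0 * ?\<phi> R \<le> real n" and "\<not> K * VL (c * R) < VG (real n)"
      then have le: "VG (real n) \<le> K * VL (c * R)" by simp
      have phi1: "1 \<le> ?\<phi> R" "x1 * C \<le> ?\<phi> R" using elim(1) by auto
      have "?\<phi> R \<le> C0 * ?\<phi> R" using C0 phi1 mult_right_mono[of 1 C0 "?\<phi> R"] by simp
      then have "x1 * C \<le> real n" using phi1 n by linarith
      then have "x1 \<le> real n / C" using C by (simp add: field_simps)
      from x1[OF this] have "fG (real n / C) \<le> A * VG (real n)"
        using C VG_nonneg[of n] by simp
      also have "\<dots> \<le> A * (K * \<bar>VL (c * R)\<bar>)"
      proof (rule mult_left_mono)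
        show "VG (real n) \<le> K * \<bar>VL (c * R)\<bar>"
          using le mult_left_mono[OF abs_ge_self[of "VL (c * R)"], of K] K by linarith
      qed (use A in simp)
      also have "\<dots> \<le> A * (K * (A2 * \<bar>fL (C2 * (c * R))\<bar>))"
        using elim(2) A K by (intro mult_left_mono) auto
      also have "\<dots> = B * fL ((C2 * c) * R)"
        using elim(5) by (simp add: B_def mult_ac)
      finally have "fG (real n / C) \<le> B * fL ((C2 * c) * R)" .
      moreover have "bG \<le> B * fL ((C2 * c) * R)"
        using elim(5) B by (simp add: field_simps)
      ultimately have "real n / C \<le> finv fG (B * fL ((C2 * c) * R))"
        using C by (intro le_finvI[OF fG bG]) auto
      also have "\<dots> \<le> D1 * \<bar>?\<phi> ((C2 * c) * R)\<bar>" using elim(3) by linarith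
      also have "\<dots> \<le> D1 * (D2 * \<bar>?\<phi> R\<bar>)" using elim(4) D1 by (intro mult_left_mono) auto
      also have "\<dots> = D1 * D2 * ?\<phi> R" using phi1 by simp
      finally have "real n \<le> C * D1 * D2 * ?\<phi> R" using C by (simp add: field_simps)
      also have "\<dots> < C0 * ?\<phi> R" using phi1 by (simp add: C0_def algebra_simps)
      finally show False using n by simp
    qed
  qed
  with that[of C0] C0 show ?thesis by simp
qed

section \<open>Truncated moments\<close>

text \<open>No concavity of \<open>\<phi>\<close> is available. At a scale \<open>R\<close> where \<open>\<phi> x / x\<close> is close to a record
  minimum, \<open>\<phi>\<close> dominates the linear function through \<open>(R, \<phi> R)\<close> up to a factor 2.\<close>

lemma ex_near_record_minimum:
  fixes \<phi> :: "real \<Rightarrow> real"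
  assumes mono: "\<And>x y. \<lbrakk>T \<le> x; x \<le> y\<rbrakk> \<Longrightarrow> \<phi> x \<le> \<phi> y"
    and pos: "0 < T" "0 < \<phi> T" and lim: "((\<lambda>x. \<phi> x / x) \<longlongrightarrow> 0) at_top"
  obtains R where "N \<le> R" "T \<le> R" "\<And>x. \<lbrakk>T \<le> x; x \<le> R\<rbrakk> \<Longrightarrow> \<phi> R / R \<le> 2 * (\<phi> x / x)"
proof -
  define N' where "N' = max N T"
  define q where "q x = \<phi> x / x" for x
  have N': "N \<le> N'" "T \<le> N'" by (auto simp: N'_def)
  \<comment> \<open>Used twice: it makes the infimum of \<open>q\<close> over a bounded interval
    positive, and it shows that a very small value of \<open>q\<close> can only occur far
    out.\<close>
  have low: "\<phi> T / y \<le> q x" if "T \<le> x" "x \<le> y" for x y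
    unfolding q_def using that pos mono[of T x] by (intro frac_le) auto
  have "0 < \<phi> T / N'" using pos N' by simp
  with lim have "\<forall>\<^sub>F x in at_top. q x < \<phi> T / N'"
    unfolding q_def by (rule order_tendstoD(2))
  then obtain R' where R': "N' \<le> R'" "q R' < \<phi> T / N'"
    unfolding eventually_at_top_linorder by (meson linear order_refl)
  define i where "i = Inf (q ` {T..R'})"
  have bdd: "bdd_below (q ` {T..R'})" using low by (intro bdd_belowI2[of _ "\<phi> T / R'"]) auto
  have ne: "q ` {T..R'} \<noteq> {}" using N' R' by auto
  have "\<phi> T / R' \<le> i" unfolding i_def using low ne by (intro cInf_greatest) auto
  then have i_pos: "0 < i" using pos N' R' by (meson divide_pos_pos less_le_trans order_trans)
  have "i \<le> q R'" unfolding i_def using bdd N' R' by (intro cInf_lower) auto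
  \<comment> \<open>The infimum need not be attained. The bound \<open>2 * i\<close> gives the
    factor 2 in the conclusion; the other bound, with \<open>low\<close>, forces \<open>R\<close>
    beyond \<open>N\<close>.\<close>
  then have "Inf (q ` {T..R'}) < min (2 * i) (\<phi> T / N')"
    using i_pos R' by (simp add: i_def[symmetric])
  from cInf_lessD[OF ne this] obtain R
    where R: "T \<le> R" "R \<le> R'" "q R < 2 * i" "q R < \<phi> T / N'" by auto
  show ?thesis
  proof
    show "N \<le> R" using low[of R N'] R N' by linarith
    show "T \<le> R" by fact
    fix x assume "T \<le> x" "x \<le> R"
    then have "i \<le> q x" unfolding i_def using bdd R by (intro cInf_lower) auto
    then show "\<phi> R / R \<le> 2 * (\<phi> x / x)" using R by (simp add: q_def)
  qed
qed

text \<open>Dominated convergence: shifting the index past \<open>T\<close> puts every tail below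
  the integrable one, and each point eventually leaves the tails because \<open>Y\<close> is
  real-valued.\<close>

lemma nn_integral_tail_tendsto_0:
  fixes Y :: "'w \<Rightarrow> real" and h :: "'w \<Rightarrow> ennreal"
  assumes [measurable]: "Y \<in> borel_measurable M" "h \<in> borel_measurable M"
    and fin: "(\<integral>\<^sup>+x. h x * indicator {T..} (Y x) \<partial>M) < \<infinity>"
  shows "(\<lambda>k. \<integral>\<^sup>+x. h x * indicator {real k..} (Y x) \<partial>M) \<longlonglongrightarrow> 0"
proof (rule LIMSEQ_offset[where k = "nat \<lceil>T\<rceil>"])
  have "(\<lambda>k. \<integral>\<^sup>+x. h x * indicator {real (k + nat \<lceil>T\<rceil>)..} (Y x) \<partial>M) \<longlonglongrightarrow> (\<integral>\<^sup>+x. 0 \<partial>M)"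
  proof (rule nn_integral_dominated_convergence[OF _ _ _ _ fin])
    fix k
    have "T \<le> real (k + nat \<lceil>T\<rceil>)" using real_nat_ceiling_ge[of T] by simp
    then show "AE x in M. h x * indicator {real (k + nat \<lceil>T\<rceil>)..} (Y x) \<le> h x * indicator {T..} (Y x)"
      by (intro AE_I2) (simp split: split_indicator)
  next
    show "AE x in M. (\<lambda>k. h x * indicator {real (k + nat \<lceil>T\<rceil>)..} (Y x)) \<longlonglongrightarrow> 0"
    proof (intro AE_I2 tendsto_eventually)
      fix x
      show "\<forall>\<^sub>F k in sequentially. h x * indicator {real (k + nat \<lceil>T\<rceil>)..} (Y x) = 0"
        using eventually_gt_at_top[of "nat \<lceil>Y x\<rceil>"]
      proof eventually_elim
        case (elim k)
        then have "Y x < real (k + nat \<lceil>T\<rceil>)" using real_nat_ceiling_ge[of "Y x"] by linarith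
        then show ?case by simp
      qed
    qed
  qed measurable
  then show "(\<lambda>k. \<integral>\<^sup>+x. h x * indicator {real (k + nat \<lceil>T\<rceil>)..} (Y x) \<partial>M) \<longlonglongrightarrow> 0"
    by simp
qed

text \<open>Values below the cut \<open>T\<close> contribute at most \<open>T * v\<close>,
  negligible against \<open>R / \<phi> R\<close> for large \<open>R\<close>. Above the cut,
  near-minimality at \<open>R\<close> bounds the truncated value by a multiple of
  \<open>\<phi>\<close>, whose tail integral is small.\<close>

lemma ex_small_truncated_moment:
  fixes Y :: "'s \<Rightarrow> 'w \<Rightarrow> real" and \<phi> :: "real \<Rightarrow> real"
  assumes S: "finite S" and D [measurable]: "D \<in> sets M" and D_fin: "emeasure M D < \<infinity>"
    and Y: "\<And>s. s \<in> S \<Longrightarrow> Y s \<in> borel_measurable M"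
    and phiY: "\<And>s. s \<in> S \<Longrightarrow> (\<lambda>x. \<phi> (Y s x)) \<in> borel_measurable M"
    and mono: "\<And>x y. \<lbrakk>T0 \<le> x; x \<le> y\<rbrakk> \<Longrightarrow> \<phi> x \<le> \<phi> y"
    and pos: "0 < T0" "0 < \<phi> T0" and lim: "((\<lambda>x. \<phi> x / x) \<longlongrightarrow> 0) at_top"
    and int: "\<And>s. s \<in> S \<Longrightarrow>
      (\<integral>\<^sup>+x. (ennreal (\<phi> (Y s x)) * indicator D x) * indicator {T0..} (Y s x) \<partial>M) < \<infinity>"
    and \<epsilon>: "0 < \<epsilon>"
  obtains R where "N \<le> R" "T0 \<le> R"
    "\<And>s. s \<in> S \<Longrightarrow> (\<integral>\<^sup>+x\<in>D. ennreal (min (Y s x) R) \<partial>M) \<le> ennreal (\<epsilon> * R / \<phi> R)"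
proof -
  define h where "h s x = ennreal (\<phi> (Y s x)) * indicator D x" for s x
  have h: "h s \<in> borel_measurable M" if "s \<in> S" for s
    using phiY[OF that] unfolding h_def[abs_def] by measurable
  have "\<forall>\<^sub>F k in sequentially. \<forall>s\<in>S. (\<integral>\<^sup>+x. h s x * indicator {real k..} (Y s x) \<partial>M) < ennreal (\<epsilon> / 4)"
  proof (rule eventually_ball_finite[OF S], rule ballI)
    fix s assume s: "s \<in> S"
    have "(\<lambda>k. \<integral>\<^sup>+x. h s x * indicator {real k..} (Y s x) \<partial>M) \<longlonglongrightarrow> 0"
      by (rule nn_integral_tail_tendsto_0[OF Y[OF s] h[OF s], of T0]) (use int[OF s] in \<open>simp add: h_def\<close>)
    then show "\<forall>\<^sub>F k in sequentially. (\<integral>\<^sup>+x. h s x * indicator {real k..} (Y s x) \<partial>M) < ennreal (\<epsilon> / 4)"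
      using \<epsilon> by (intro order_tendstoD(2)) auto
  qed
  moreover have "\<forall>\<^sub>F k in sequentially. T0 \<le> real k"
    by (rule eventually_sequentiallyI[of "nat \<lceil>T0\<rceil>"]) linarith
  ultimately have "\<forall>\<^sub>F k in sequentially. T0 \<le> real k \<and>
      (\<forall>s\<in>S. (\<integral>\<^sup>+x. h s x * indicator {real k..} (Y s x) \<partial>M) < ennreal (\<epsilon> / 4))"
    by eventually_elim simp
  \<comment> \<open>Finiteness of \<open>S\<close> allows one cut for all \<open>s\<close>. The
    bound \<open>\<epsilon> / 4\<close> is doubled by the factor in \<open>dom\<close>, leaving
    \<open>\<epsilon> / 2\<close> for the part below the cut.\<close>
  then obtain k where k: "T0 \<le> real k"
    "\<And>s. s \<in> S \<Longrightarrow> (\<integral>\<^sup>+x. h s x * indicator {real k..} (Y s x) \<partial>M) < ennreal (\<epsilon> / 4)"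
    by (auto simp: eventually_sequentially)
  define T where "T = real k"
  define v where "v = measure M D"
  have v: "emeasure M D = ennreal v" "0 \<le> v"
    using D_fin by (auto simp: v_def intro: emeasure_eq_ennreal_measure)
  have T: "T0 \<le> T" "0 < T" using k pos by (auto simp: T_def)
  have phi_pos: "0 < \<phi> x" if "T \<le> x" for x using mono[of T0 x] T that pos by simp
  have "((\<lambda>x. \<phi> x / x * (T * v)) \<longlongrightarrow> 0 * (T * v)) at_top" by (intro tendsto_intros lim)
  then have "\<forall>\<^sub>F x in at_top. \<phi> x / x * (T * v) < \<epsilon> / 2"
    using \<epsilon> by (intro order_tendstoD(2)) auto
  then obtain N2 where N2: "\<And>x. N2 \<le> x \<Longrightarrow> \<phi> x / x * (T * v) < \<epsilon> / 2"
    by (auto simp: eventually_at_top_linorder)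
  have mono_T: "\<phi> x \<le> \<phi> y" if "T \<le> x" "x \<le> y" for x y using mono T that by simp
  obtain R where R: "max N N2 \<le> R" "T \<le> R"
    and rec: "\<And>x. \<lbrakk>T \<le> x; x \<le> R\<rbrakk> \<Longrightarrow> \<phi> R / R \<le> 2 * (\<phi> x / x)"
    using ex_near_record_minimum[OF mono_T T(2) phi_pos[OF order_refl] lim, of "max N N2"] by blast
  have R_pos: "0 < R" "0 < \<phi> R" using R T phi_pos by auto
  \<comment> \<open>Up to \<open>R\<close> this is the near-minimality of
    \<open>\<phi> x / x\<close> at \<open>R\<close>; beyond \<open>R\<close>, where the left side is
    constant, it is monotonicity.\<close>
  have dom: "min y R \<le> 2 * R / \<phi> R * \<phi> y" if y: "T \<le> y" for y
  proof (cases "y \<le> R")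
    case True
    then have "\<phi> R * y \<le> 2 * R * \<phi> y"
      using rec[OF y True] y T R_pos by (simp add: field_simps)
    then show ?thesis using True R_pos by (simp add: field_simps)
  next
    case False
    then have "\<phi> R \<le> \<phi> y" using mono[of R y] R T by simp
    then have "R * \<phi> R \<le> R * (2 * \<phi> y)" using R_pos by (intro mult_left_mono) auto
    then show ?thesis using False R_pos by (simp add: field_simps)
  qed
  have "(\<integral>\<^sup>+x\<in>D. ennreal (min (Y s x) R) \<partial>M) \<le> ennreal (\<epsilon> * R / \<phi> R)" if s: "s \<in> S" for s
  proof -
    note [measurable] = Y[OF s] h[OF s]
    have pointwise: "ennreal (min (Y s x) R) * indicator D x
        \<le> ennreal T * indicator D x + ennreal (2 * R / \<phi> R) * (h s x * indicator {real k..} (Y s x))" for x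
    proof (cases "x \<in> D \<and> T \<le> Y s x")
      case True
      have "ennreal (min (Y s x) R) \<le> ennreal (2 * R / \<phi> R * \<phi> (Y s x))"
        using dom True by (intro ennreal_leI) simp
      also have "\<dots> = ennreal (2 * R / \<phi> R) * ennreal (\<phi> (Y s x))"
        using R_pos phi_pos[of "Y s x"] True by (intro ennreal_mult) auto
      finally have "ennreal (min (Y s x) R) \<le> ennreal (2 * R / \<phi> R) * ennreal (\<phi> (Y s x))" .
      then show ?thesis using True by (simp add: h_def T_def add_increasing)
    next
      case False
      then show ?thesis
        by (cases "x \<in> D") (auto simp: T_def intro!: add_increasing2 ennreal_leI)
    qed
    have "(\<integral>\<^sup>+x\<in>D. ennreal (min (Y s x) R) \<partial>M)
        \<le> (\<integral>\<^sup>+x. ennreal T * indicator D x + ennreal (2 * R / \<phi> R) * (h s x * indicator {real k..} (Y s x)) \<partial>M)"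
      using pointwise by (rule nn_integral_mono)
    also have "\<dots> = ennreal T * emeasure M D
        + ennreal (2 * R / \<phi> R) * (\<integral>\<^sup>+x. h s x * indicator {real k..} (Y s x) \<partial>M)"
      by (subst nn_integral_add) (auto simp: nn_integral_cmult nn_integral_cmult_indicator)
    also have "\<dots> \<le> ennreal T * ennreal v + ennreal (2 * R / \<phi> R) * ennreal (\<epsilon> / 4)"
      using k(2)[OF s] v by (intro add_mono mult_left_mono) auto
    also have "\<dots> = ennreal (T * v + 2 * R / \<phi> R * (\<epsilon> / 4))"
      using T v \<epsilon> R_pos by (simp add: ennreal_mult[symmetric] ennreal_plus[symmetric] del: ennreal_plus)
    also have "\<dots> \<le> ennreal (\<epsilon> * R / \<phi> R)"
    proof (rule ennreal_leI)
      have "\<phi> R * (T * v) \<le> R * (\<epsilon> / 2)"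
        using N2[of R] R R_pos by (simp add: field_simps)
      then have "T * v \<le> R * (\<epsilon> / 2) / \<phi> R" using R_pos by (simp add: field_simps)
      then show "T * v + 2 * R / \<phi> R * (\<epsilon> / 4) \<le> \<epsilon> * R / \<phi> R" by (simp add: field_simps)
    qed
    finally show ?thesis .
  qed
  then show ?thesis using that[of R] R T by simp
qed

section \<open>Comparison of volume growths\<close>

context coupled_actions
begin

text \<open>Markov's inequality for the truncated length \<open>\<theta>\<close>, which equals
  \<open>R\<close> on the far set. Truncation preserves monotonicity and subadditivity, so the bound
  along words applies.\<close>

lemma measure_cocycle_far_le:
  assumes SG: "SG \<subseteq> carrier G" and SL: "fin_gen_set L SL"
    and pos: "0 < c" "0 < R" "0 \<le> B"
    and B: "\<And>s. s \<in> SG \<union> m_inv G ` SG \<union> {\<one>\<^bsub>G\<^esub>} \<Longrightarrow>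
      (\<integral>\<^sup>+x\<in>XL. ennreal (min (real (word_length L SL (cocycle s x)) / c) R) \<partial>M) \<le> ennreal B"
    and g: "g \<in> word_ball G SG n"
  shows "R * measure M {x \<in> XL. nat \<lfloor>c * R\<rfloor> < word_length L SL (cocycle g x)} \<le> real n * B"
proof -
  define \<theta> where "\<theta> k = ennreal (min (real k / c) R)" for k :: nat
  let ?Z = "{x \<in> XL. nat \<lfloor>c * R\<rfloor> < word_length L SL (cocycle g x)}"
  have gc: "g \<in> carrier G" using g G.word_ball_subset_carrier[OF SG] by blast
  have [measurable]: "(\<lambda>x. word_length L SL (cocycle g x)) \<in> measurable M (count_space UNIV)"
    by (rule cocycle_function_measurable[OF gc])
  have "?Z = XL \<inter> {x \<in> space M. nat \<lfloor>c * R\<rfloor> < word_length L SL (cocycle g x)}"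
    using XL_space by auto
  also have "\<dots> \<in> sets M" by simp
  finally have Z [measurable]: "?Z \<in> sets M" .
  have "ennreal R * emeasure M ?Z = (\<integral>\<^sup>+x. ennreal R * indicator ?Z x \<partial>M)"
    by (simp add: nn_integral_cmult_indicator)
  also have "\<dots> \<le> (\<integral>\<^sup>+x\<in>XL. \<theta> (word_length L SL (cocycle g x)) \<partial>M)"
  proof (rule nn_integral_mono)
    fix x
    show "ennreal R * indicator ?Z x \<le> \<theta> (word_length L SL (cocycle g x)) * indicator XL x"
    proof (cases "x \<in> ?Z")
      case True
      \<comment> \<open>An integer above the floor of \<open>c * R\<close> exceeds
        \<open>c * R\<close> itself.\<close>
      then have "c * R \<le> real (word_length L SL (cocycle g x))" by simp linarith
      then have "R \<le> real (word_length L SL (cocycle g x)) / c" using pos by (simp add: field_simps)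
      then show ?thesis using True by (simp add: \<theta>_def min_def)
    qed simp
  qed
  also have "\<dots> \<le> of_nat n * ennreal B"
  proof (rule nn_integral_cocycle_word_length_le[OF SG SL _ _ _ _ g])
    show "\<theta> i \<le> \<theta> j" if "i \<le> j" for i j
      unfolding \<theta>_def using that pos by (intro ennreal_leI min.mono divide_right_mono) auto
    show "\<theta> (i + j) \<le> \<theta> i + \<theta> j" for i j
    proof -
      have "0 \<le> real i / c" "0 \<le> real j / c" using pos by simp_all
      then have "min (real (i + j) / c) R \<le> min (real i / c) R + min (real j / c) R"
        using pos unfolding of_nat_add add_divide_distrib by linarith
      then have "\<theta> (i + j) \<le> ennreal (min (real i / c) R + min (real j / c) R)"
        unfolding \<theta>_def by (rule ennreal_leI)
      also have "\<dots> = \<theta> i + \<theta> j" unfolding \<theta>_def using pos by (intro ennreal_plus) auto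
      finally show ?thesis .
    qed
    show "\<theta> 0 = 0" using pos by (simp add: \<theta>_def)
  qed (use B in \<open>simp add: \<theta>_def\<close>)
  also have "\<dots> = ennreal (real n * B)"
    using pos by (simp add: ennreal_of_nat_eq_real_of_nat ennreal_mult)
  also have "ennreal R * emeasure M ?Z = ennreal (R * measure M ?Z)"
    using pos subset_XL_emeasure[OF _ Z] by (simp add: ennreal_mult)
  finally show ?thesis using pos by (simp add: ennreal_le_iff)
qed

text \<open>The order of quantifiers matters: \<open>c\<close> comes from the integrability scales
  and \<open>K\<close> from the orbit counts, both fixed before \<open>C\<close>. Only the scales
  \<open>R\<close> depend on \<open>C\<close>.\<close>

lemma ex_word_ball_growth_bound:
  fixes \<phi> :: "real \<Rightarrow> real"
  assumes SG: "fin_gen_set G SG" and SL: "fin_gen_set L SL"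
    and int: "phi_integrable_cocycle \<phi> G L SL M aG aL XL"
    and mono: "\<And>x y. \<lbrakk>T0 \<le> x; x \<le> y\<rbrakk> \<Longrightarrow> \<phi> x \<le> \<phi> y"
    and pos: "0 < T0" "0 < \<phi> T0" and lim: "((\<lambda>x. \<phi> x / x) \<longlongrightarrow> 0) at_top"
  obtains c :: real and K :: nat where "0 < c"
    "\<forall>C>0. \<forall>N. \<exists>R\<ge>N. \<forall>n. real n \<le> C * \<phi> R \<longrightarrow>
      vol_nat G SG n \<le> 4 * real K * vol_nat L SL (nat \<lfloor>c * R\<rfloor>)"
proof -
  define S where "S = SG \<union> m_inv G ` SG \<union> {\<one>\<^bsub>G\<^esub>}"
  have SGc: "SG \<subseteq> carrier G" and finS: "finite S" using SG by (auto simp: fin_gen_set_def S_def)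
  have Sc: "s \<in> carrier G" if "s \<in> S" for s
    using that G.symmetrised_closed[OF SGc] by (simp add: S_def)
  have "\<forall>s\<in>S. \<exists>d>0. (\<integral>\<^sup>+x\<in>XL. ennreal (\<phi> (real (word_length L SL (cocycle s x)) / d)) \<partial>M) < \<infinity>"
    using int Sc unfolding phi_integrable_cocycle_def by simp
  then obtain d where d: "\<And>s. s \<in> S \<Longrightarrow> 0 < d s"
    "\<And>s. s \<in> S \<Longrightarrow> (\<integral>\<^sup>+x\<in>XL. ennreal (\<phi> (real (word_length L SL (cocycle s x)) / d s)) \<partial>M) < \<infinity>"
    by metis
  \<comment> \<open>A single scale for all generators: enlarging the divisor decreases the argument
    of \<open>\<phi>\<close>.\<close>
  define c where "c = Max (d ` S)"
  have d_le: "d s \<le> c" if "s \<in> S" for s unfolding c_def using that finS by simp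
  have oneS: "\<one>\<^bsub>G\<^esub> \<in> S" by (simp add: S_def)
  have c: "0 < c" using d(1)[OF oneS] d_le[OF oneS] by simp
  obtain K :: nat where K: "measure M XL / 2 \<le> measure M {x \<in> XL. orbit_count G aG XL x \<le> of_nat K}"
    by (rule ex_bounded_orbit_count)
  define Y where "Y s x = real (word_length L SL (cocycle s x)) / c" for s x
  have meas: "(\<lambda>x. h (word_length L SL (cocycle s x))) \<in> borel_measurable M" if "s \<in> S"
    for h :: "nat \<Rightarrow> real" and s
    using measurable_compose[OF cocycle_measurable[OF Sc[OF that]],
        of "\<lambda>l. h (word_length L SL l)" borel] by simp
  \<comment> \<open>Monotonicity of \<open>\<phi>\<close> is available only from \<open>T0\<close>
    on, so the change of scale is made on that part.\<close>
  have intY: "(\<integral>\<^sup>+x. (ennreal (\<phi> (Y s x)) * indicator XL x) * indicator {T0..} (Y s x) \<partial>M) < \<infinity>"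
    if s: "s \<in> S" for s
  proof -
    have "(ennreal (\<phi> (Y s x)) * indicator XL x) * indicator {T0..} (Y s x)
        \<le> ennreal (\<phi> (real (word_length L SL (cocycle s x)) / d s)) * indicator XL x" for x
    proof (cases "T0 \<le> Y s x")
      case True
      have "Y s x \<le> real (word_length L SL (cocycle s x)) / d s"
        unfolding Y_def using d(1)[OF s] d_le[OF s] by (intro divide_left_mono) auto
      then have "ennreal (\<phi> (Y s x)) \<le> ennreal (\<phi> (real (word_length L SL (cocycle s x)) / d s))"
        using True by (intro ennreal_leI mono)
      then show ?thesis using True by (simp split: split_indicator)
    qed simp
    then have "(\<integral>\<^sup>+x. (ennreal (\<phi> (Y s x)) * indicator XL x) * indicator {T0..} (Y s x) \<partial>M)
        \<le> (\<integral>\<^sup>+x\<in>XL. ennreal (\<phi> (real (word_length L SL (cocycle s x)) / d s)) \<partial>M)"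
      by (intro nn_integral_mono) blast
    then show ?thesis using d(2)[OF s] by (rule le_less_trans)
  qed
  have "\<exists>R\<ge>N. \<forall>n. real n \<le> C * \<phi> R \<longrightarrow> vol_nat G SG n \<le> 4 * real K * vol_nat L SL (nat \<lfloor>c * R\<rfloor>)"
    if C: "0 < C" for C N
  proof -
    \<comment> \<open>Chosen so that \<open>n\<close> at most \<open>C * \<phi> R\<close> makes the
      far set at most a quarter of \<open>XL\<close>, as \<open>card_le_word_ball\<close>
      demands.\<close>
    let ?e = "measure M XL / (4 * C)"
    have e: "0 < ?e" using C XL_measure_pos by simp
    have Y_meas: "Y s \<in> borel_measurable M" "(\<lambda>x. \<phi> (Y s x)) \<in> borel_measurable M" if "s \<in> S" for s
      using meas[OF that, of "\<lambda>k. real k / c"] meas[OF that, of "\<lambda>k. \<phi> (real k / c)"]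
      by (simp_all add: Y_def[abs_def])
    obtain R where R: "N \<le> R" "T0 \<le> R"
      "\<And>s. s \<in> S \<Longrightarrow> (\<integral>\<^sup>+x\<in>XL. ennreal (min (Y s x) R) \<partial>M) \<le> ennreal (?e * R / \<phi> R)"
      using ex_small_truncated_moment[where N = N and Y = Y,
          OF finS XL_sets XL_finite Y_meas mono pos lim intY e] by blast
    have R_pos: "0 < R" "0 < \<phi> R" using R(2) pos mono[of T0 R] by auto
    have "vol_nat G SG n \<le> 4 * real K * vol_nat L SL (nat \<lfloor>c * R\<rfloor>)" if n: "real n \<le> C * \<phi> R" for n
      unfolding vol_nat_def
    proof (rule card_le_word_ball[OF K SL])
      show "finite (word_ball G SG n)" using SG G.finite_word_ball by (simp add: fin_gen_set_def)
      show "word_ball G SG n \<subseteq> carrier G" by (rule G.word_ball_subset_carrier[OF SGc])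
      fix g assume g: "g \<in> word_ball G SG n"
      have "R * measure M {x \<in> XL. nat \<lfloor>c * R\<rfloor> < word_length L SL (cocycle g x)}
          \<le> real n * (?e * R / \<phi> R)"
        using R(3) R_pos C by (intro measure_cocycle_far_le[OF SGc SL c _ _ _ g])
          (auto simp: S_def Y_def)
      also have "\<dots> \<le> (C * \<phi> R) * (?e * R / \<phi> R)"
        using n e R_pos by (intro mult_right_mono) auto
      also have "\<dots> = R * (measure M XL / 4)" using C R_pos by (simp add: field_simps)
      finally show "measure M {x \<in> XL. nat \<lfloor>c * R\<rfloor> < word_length L SL (cocycle g x)} \<le> measure M XL / 4"
        using R_pos by (simp only: mult_le_cancel_left_pos)
    qed
    then show ?thesis using R(1) by blast
  qed
  then have "\<forall>C>0. \<forall>N. \<exists>R\<ge>N. \<forall>n. real n \<le> C * \<phi> R \<longrightarrow>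
      vol_nat G SG n \<le> 4 * real K * vol_nat L SL (nat \<lfloor>c * R\<rfloor>)"
    by blast
  with c show ?thesis by (rule that)
qed

end

section \<open>Contradiction between the two volume comparisons\<close>

theorem theoremD:
  fixes G :: "('g, 'b) monoid_scheme" and L :: "('l, 'c) monoid_scheme"
    and SG :: "'g set" and SL :: "'l set"
    and fG fL :: "real \<Rightarrow> real"
  assumes "group G" and "group L"
    and "fin_gen_set G SG" and "fin_gen_set L SL"
    and "strict_mono_on {0..} fG" and "strict_mono_on {0..} fL"
    and "\<exists>a. {a..} \<subseteq> fG ` {0..}" and "\<exists>a. {a..} \<subseteq> fL ` {0..}"
    and "asym_eq fG (vol_growth G SG)" and "asym_eq fL (vol_growth L SL)"
    and "finv fG \<in> o[at_top](finv fL)"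
    and "\<forall>C>0. (\<lambda>x. finv fG (C * x)) \<in> O[at_top](finv fG)"
    and "\<forall>C>0. (\<lambda>x. finv fG (fL (C * x))) \<in> O[at_top](\<lambda>x. finv fG (fL x))"
  shows "\<not> (\<exists>(M :: 'w::polish_space measure) aG aL XG XL.
            phi_L0_coupling (\<lambda>x. finv fG (fL x)) G L SL M aG aL XG XL)"
proof
  note SG = assms(3) and SL = assms(4) and fG = assms(5) and fL = assms(6)
  assume "\<exists>(M :: 'w measure) aG aL XG XL. phi_L0_coupling (\<lambda>x. finv fG (fL x)) G L SL M aG aL XG XL"
  then obtain M :: "'w measure" and aG aL XG XL
    where coupling: "me_coupling G L M aG aL XG XL"
      and int: "phi_integrable_cocycle (\<lambda>x. finv fG (fL x)) G L SL M aG aL XL"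
    unfolding phi_L0_coupling_def by blast
  interpret G: group G by fact
  interpret L: group L by fact
  interpret coupled_actions G L M aG aL XG XL
    using coupling G.countable_carrier[OF SG] L.countable_carrier[OF SL] unfolding me_coupling_def
    by unfold_locales blast+
  obtain bG bL where bG: "{bG..} \<subseteq> fG ` {0..}" and bL: "{bL..} \<subseteq> fL ` {0..}"
    using assms(7,8) by blast
  define \<phi> where "\<phi> x = finv fG (fL x)" for x
  have fL_top: "filterlim fL at_top at_top" by (rule filterlim_growth_at_top[OF fL bL])
  have phi_top: "filterlim \<phi> at_top at_top"
    unfolding \<phi>_def by (rule filterlim_compose[OF filterlim_finv_at_top[OF fG bG] fL_top])
  have "\<forall>\<^sub>F x in at_top. 0 < x \<and> bG \<le> fL x \<and> 1 \<le> \<phi> x"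
    using eventually_gt_at_top[of 0] fL_top phi_top unfolding filterlim_at_top
    by (intro eventually_conj) blast+
  \<comment> \<open>Beyond \<open>T0\<close>, \<open>fL x\<close> stays in the range where
    \<open>finv fG\<close> is monotone, and \<open>\<phi>\<close> is positive.\<close>
  then obtain T0 where "0 < T0 \<and> bG \<le> fL T0 \<and> 1 \<le> \<phi> T0"
    unfolding eventually_at_top_linorder by blast
  then have T0: "0 < T0" "bG \<le> fL T0" "0 < \<phi> T0" by simp_all
  have mono: "\<phi> x \<le> \<phi> y" if "T0 \<le> x" "x \<le> y" for x y
  proof -
    have "fL T0 \<le> fL x" "fL x \<le> fL y"
      using that T0 by (auto intro!: strict_mono_on_leD[OF fL])
    then show ?thesis unfolding \<phi>_def using T0 by (intro finv_mono[OF fG bG]) auto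
  qed
  \<comment> \<open>Hypothesis (i) composed with \<open>fL\<close>: the denominator becomes
    \<open>x\<close>, so \<open>\<phi>\<close> is sublinear.\<close>
  have "(\<lambda>x. finv fG (fL x)) \<in> o[at_top](\<lambda>x. finv fL (fL x))"
    by (rule landau_o.small.compose[OF assms(11) fL_top])
  then have "((\<lambda>x. finv fG (fL x) / finv fL (fL x)) \<longlongrightarrow> 0) at_top"
    by (rule smalloD_tendsto)
  moreover have "\<forall>\<^sub>F x in at_top. finv fG (fL x) / finv fL (fL x) = \<phi> x / x"
    using eventually_ge_at_top[of 0] by eventually_elim (simp add: \<phi>_def finv_of[OF fL bL])
  ultimately have lim: "((\<lambda>x. \<phi> x / x) \<longlongrightarrow> 0) at_top" by (rule Lim_transform_eventually)
  obtain c and K :: nat where c: "0 < c"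
    and bound: "\<forall>C>0. \<forall>N. \<exists>R\<ge>N. \<forall>n. real n \<le> C * \<phi> R \<longrightarrow>
      vol_nat G SG n \<le> 4 * real K * vol_nat L SL (nat \<lfloor>c * R\<rfloor>)"
    by (rule ex_word_ball_growth_bound[OF SG SL int[folded \<phi>_def] mono T0(1,3) lim])
  have VG: "asym_le fG (vol_growth G SG)" and VL: "asym_le (vol_growth L SL) fL"
    using assms(9,10) by (simp_all add: asym_eq_def)
  have vol_nonneg: "0 \<le> vol_growth G SG (real n)" for n by (simp add: vol_nat_def)
  \<comment> \<open>The added 1 gives a positive constant even if \<open>K\<close> is 0, and leaves
    one copy of \<open>vol_growth L SL (c * R)\<close> to be negative at the end.\<close>
  have K1: "0 < 4 * real K + 1" by simp
  obtain C0 where C0: "0 < C0" and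
    gap: "\<forall>\<^sub>F R in at_top. \<forall>n::nat. C0 * finv fG (fL R) \<le> real n \<longrightarrow>
      (4 * real K + 1) * vol_growth L SL (c * R) < vol_growth G SG (real n)"
    by (rule growth_gap[OF fG bG fL bL VG VL assms(12,13) vol_nonneg K1 c])
  have "\<forall>\<^sub>F R in at_top. 0 \<le> R \<and> 1 / C0 \<le> \<phi> R \<and> (\<forall>n::nat. C0 * \<phi> R \<le> real n \<longrightarrow>
      (4 * real K + 1) * vol_growth L SL (c * R) < vol_growth G SG (real n))"
    using eventually_ge_at_top[of 0] phi_top gap unfolding filterlim_at_top \<phi>_def[symmetric]
    by (intro eventually_conj) blast+
  then obtain N where N: "\<And>R. N \<le> R \<Longrightarrow> 0 \<le> R \<and> 1 / C0 \<le> \<phi> R \<and> (\<forall>n::nat. C0 * \<phi> R \<le> real n \<longrightarrow>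
      (4 * real K + 1) * vol_growth L SL (c * R) < vol_growth G SG (real n))"
    by (auto simp: eventually_at_top_linorder)
  \<comment> \<open>Doubling \<open>C0\<close> leaves room for an integer \<open>n\<close> between
    \<open>C0 * \<phi> R\<close> and its double, since \<open>C0 * \<phi> R\<close> is at least 1.
    Both comparisons then hold for the same \<open>n\<close> and \<open>R\<close>.\<close>
  obtain R where R: "N \<le> R" and bound_R: "\<And>n. real n \<le> (2 * C0) * \<phi> R \<Longrightarrow>
      vol_nat G SG n \<le> 4 * real K * vol_nat L SL (nat \<lfloor>c * R\<rfloor>)"
    using bound[rule_format, of "2 * C0" N] C0 by auto
  define n where "n = nat \<lfloor>(2 * C0) * \<phi> R\<rfloor>"
  have phi_large: "1 \<le> C0 * \<phi> R" using N[OF R] C0 by (simp add: field_simps)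
  have n: "real n \<le> (2 * C0) * \<phi> R" "C0 * \<phi> R \<le> real n"
    unfolding n_def using phi_large by linarith+
  have "(4 * real K + 1) * vol_growth L SL (c * R) < vol_growth G SG (real n)"
    using N[OF R] n(2) by blast
  also have "\<dots> \<le> 4 * real K * vol_nat L SL (nat \<lfloor>c * R\<rfloor>)" using bound_R[OF n(1)] by simp
  also have "\<dots> \<le> 4 * real K * vol_growth L SL (c * R)"
    using L.vol_nat_floor_le_vol_growth[OF SL, of "c * R"] N[OF R] c by (intro mult_left_mono) auto
  finally have "vol_growth L SL (c * R) < 0" by (simp add: algebra_simps)
  moreover have "0 \<le> vol_nat L SL (nat \<lfloor>c * R\<rfloor>)" by (simp add: vol_nat_def)
  ultimately show False
    using L.vol_nat_floor_le_vol_growth[OF SL, of "c * R"] N[OF R] c by simp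
qed

end
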